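(* Let $\gamma>0$, $\tau<0$, $\rho=\gamma\tau$. Let $F \in \mathcal{F}(\gamma,\tau)$ with $F(0)=0$, with associated functions $\delta$ and $a$ (defined in the context), and let $X_1,\ldots,X_n$ be independent random variables with common distribution function $F$. Let $k = k_n \in \{1,\ldots,n-1\}$ be an intermediate integer sequence, that is, $k\to\infty$ and $k/n\to 0$ as $n\to\infty$, satisfying $\sqrt{k}\,a(n/k) \to \lambda \in \mathbb{R}$ as $n\to\infty$. Let $x_n \to \infty$ and let $p_n = \overline{F}(x_n)$ be such that $n p_n/k \to q$ as $n \to \infty$ for some $0<q<1$. Let $\hat\gamma_n$, $\hat\delta_n$, $\hat\tau_n$ be estimator sequences such that, with $\delta_n = \delta(X_{n-k:n})$, $\Gamma_{k,n} = \sqrt{k}(\hat\gamma_n-\gamma)$, $\Delta_{k,n} = \sqrt{k}(\hat\delta_n - \delta_n)$ and $Z_{k,n} = \sqrt{k}\{n\overline{F}(X_{n-k:n})/k-1\}$, $$\hat\tau_n = \tau + o_p(1) \quad\text{and}\quad (\Gamma_{k,n},\Delta_{k,n},Z_{k,n}) \rightsquigarrow (\Gamma,\Delta,Z), \qquad n\to\infty,$$ for some trivariate random vector $(\Gamma,\Delta,Z)$. Define the tail probability estimator $$\hat p_{k,n} = \frac{k}{n}\,\overline{G}_{\hat\gamma_n,\hat\delta_n,\hat\tau_n}(x_n/X_{n-k:n}).$$ Then $$\sqrt{k}\left(\frac{\hat p_{k,n}}{p_n} - 1\right) \rightsquigarrow -\gamma^{-1}\Gamma\log q - \gamma^{-1}\Delta(1-q^{-\rho})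 - Z, \qquad n\to\infty.$$
   Context: The arrow $\rightsquigarrow$ denotes convergence in distribution, and $o_p(1)$ denotes convergence to zero in probability. For a distribution function $F$ write $\overline{F} = 1-F$. Order statistics of the sample are denoted $X_{1:n}\leq\cdots\leq X_{n:n}$. A positive measurable function $f$ defined in a right neighborhood of infinity is regularly varying with index $\beta \in \mathbb{R}$, written $f \in \mathcal{R}_\beta$, if $\lim_{u\to\infty} f(ux)/f(u) = x^\beta$ for all $x \in (0,\infty)$. The class $\mathcal{F}(\gamma,\tau)$ ($\gamma>0$, $\tau<0$): a distribution function $F$ belongs to $\mathcal{F}(\gamma,\tau)$ if $x^{1/\gamma}\overline{F}(x) \to C \in (0,\infty)$ as $x \to \infty$ and if the function $\delta$ defined via $\overline{F}(x) = C x^{-1/\gamma}\{1 + \gamma^{-1}\delta(x)\}$ is eventually nonzero and of constant sign and satisfies $|\delta| \in \mathcal{R}_\tau$. Tail quantile function: $U(y) = Q(1-1/y)$ for $y \in (1,\infty)$, where $Q(p) = \inf\{x \in \mathbb{R} : F(x) \geq p\}$, $p \in (0,1)$. The function $a$ is defined implicitly by $U(y) = C^\gamma y^\gamma\{1 + a(y)\}$, with $C = \lim_{x\to\infty} x^{1/\gamma}\overline{F}(x)$. Extended Pareto Distribution (EPD): for parameters $\tau < 0 < \gamma$ and $\delta > \max(-1, 1/\tau)$, its distribution function is $G_{\gamma,\delta,\tau}(y) = 1 - \{y(1+\delta-\delta y^\tau)\}^{-1/\gamma}$ for $y > 1$ and $G_{\gamma,\delta,\tau}(y) = 0$ for $y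 \leq 1$; $\overline{G}_{\gamma,\delta,\tau} = 1 - G_{\gamma,\delta,\tau}$. The estimator $\hat p_{k,n}$ may be given arbitrary values on events where the estimated parameters fall outside the EPD parameter range. *)

theory Defs
  imports "HOL-Probability.Probability"
begin

section \<open>Modes of convergence\<close>

definition conv_in_prob :: "'a measure \<Rightarrow> (nat \<Rightarrow> 'a \<Rightarrow> real) \<Rightarrow> real \<Rightarrow> bool" where
  "conv_in_prob M Y c \<longleftrightarrow>
     (\<forall>\<epsilon>>0. (\<lambda>n. measure M {\<omega> \<in> space M. \<bar>Y n \<omega> - c\<bar> > \<epsilon>}) \<longlonglongrightarrow> 0)"

text \<open>
  The library only has weak convergence of measures on the real line (\<^const>\<open>weak_conv_m\<close>).
  For random vectors we use bounded continuous test functions; lemma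
  \<open>conv_in_distr_real_iff\<close> below shows that for real random variables this is \<^const>\<open>weak_conv_m\<close>.
\<close>

definition conv_in_distr ::
    "'a measure \<Rightarrow> (nat \<Rightarrow> 'a \<Rightarrow> 'c::metric_space) \<Rightarrow> 'b measure \<Rightarrow> ('b \<Rightarrow> 'c) \<Rightarrow> bool" where
  "conv_in_distr M Y N Z \<longleftrightarrow>
     (\<forall>f :: 'c \<Rightarrow> real. continuous_on UNIV f \<longrightarrow> bounded (range f) \<longrightarrow>
        (\<lambda>n. integral\<^sup>L M (\<lambda>\<omega>. f (Y n \<omega>))) \<longlonglongrightarrow> integral\<^sup>L N (\<lambda>\<omega>. f (Z \<omega>)))"

lemma conv_in_distr_real_iff:
  fixes Y :: "nat \<Rightarrow> 'a \<Rightarrow> real" and Z :: "'b \<Rightarrow> real"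
  assumes "prob_space M" "prob_space N"
    and Y [measurable]: "\<And>n. Y n \<in> borel_measurable M"
    and Z [measurable]: "Z \<in> borel_measurable N"
  shows "conv_in_distr M Y N Z \<longleftrightarrow>
           weak_conv_m (\<lambda>n. distr M borel (Y n)) (distr N borel Z)"
proof
  assume *: "conv_in_distr M Y N Z"
  interpret D: real_distribution "distr M borel (Y n)" for n
    by (intro prob_space.real_distribution_distr assms)
  interpret E: real_distribution "distr N borel Z"
    by (intro prob_space.real_distribution_distr assms)
  show "weak_conv_m (\<lambda>n. distr M borel (Y n)) (distr N borel Z)"
  proof (rule integral_bdd_continuous_conv_imp_weak_conv)
    fix f :: "real \<Rightarrow> real"
    assume f: "\<And>x. isCont f x" "\<And>x. \<bar>f x\<bar> \<le> 1"
    have c: "continuous_on UNIV f" using f by (simp add: continuous_at_imp_continuous_on)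
    then have [measurable]: "f \<in> borel_measurable borel"
      by (rule borel_measurable_continuous_onI)
    have "bounded (range f)" using f(2) by (auto simp: bounded_iff)
    with * c show "(\<lambda>n. integral\<^sup>L (distr M borel (Y n)) f) \<longlonglongrightarrow> integral\<^sup>L (distr N borel Z) f"
      unfolding conv_in_distr_def by (simp add: integral_distr)
  qed (unfold_locales)
next
  assume *: "weak_conv_m (\<lambda>n. distr M borel (Y n)) (distr N borel Z)"
  show "conv_in_distr M Y N Z"
    unfolding conv_in_distr_def
  proof (intro allI impI)
    fix f :: "real \<Rightarrow> real"
    assume c: "continuous_on UNIV f" and b: "bounded (range f)"
    have [measurable]: "f \<in> borel_measurable borel"
      using c by (rule borel_measurable_continuous_onI)
    obtain B where B: "\<And>x. norm (f x) \<le> B" using b by (auto simp: bounded_iff)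
    have "(\<lambda>n. integral\<^sup>L (distr M borel (Y n)) f) \<longlonglongrightarrow> integral\<^sup>L (distr N borel Z) f"
      by (rule weak_conv_imp_integral_bdd_continuous_conv[OF _ _ * _ B])
        (use c assms in \<open>auto simp: continuous_on_eq_continuous_at
            intro!: prob_space.real_distribution_distr\<close>)
    then show "(\<lambda>n. integral\<^sup>L M (\<lambda>\<omega>. f (Y n \<omega>))) \<longlonglongrightarrow> integral\<^sup>L N (\<lambda>\<omega>. f (Z \<omega>))"
      by (simp add: integral_distr)
  qed
qed

section \<open>The tail of a distribution function\<close>

definition regularly_varying :: "real \<Rightarrow> (real \<Rightarrow> real) \<Rightarrow> bool" where
  "regularly_varying \<beta> f \<longleftrightarrow>
     (\<exists>A. (\<forall>x>A. f x > 0) \<and> f \<in> borel_measurable (restrict_space borel {A<..})) \<and>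
     (\<forall>x>0. ((\<lambda>u. f (u * x) / f u) \<longlongrightarrow> x powr \<beta>) at_top)"

text \<open>\<open>tail_const \<gamma> F\<close> is the constant \<open>C\<close>; it is meaningful only if the limit exists.\<close>

definition tail_const :: "real \<Rightarrow> (real \<Rightarrow> real) \<Rightarrow> real" where
  "tail_const \<gamma> F = Lim at_top (\<lambda>x. x powr (1 / \<gamma>) * (1 - F x))"

text \<open>The defining equation \<open>1 - F x = C x\<^bsup>-1/\<gamma>\<^esup> (1 + \<delta> x / \<gamma>)\<close>, solved for \<open>\<delta> x\<close>
  (see \<open>tail_delta_eq\<close>).\<close>

definition tail_delta :: "real \<Rightarrow> (real \<Rightarrow> real) \<Rightarrow> real \<Rightarrow> real" where
  "tail_delta \<gamma> F x = \<gamma> * (x powr (1 / \<gamma>) * (1 - F x) / tail_const \<gamma> F - 1)"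

definition tail_class :: "real \<Rightarrow> real \<Rightarrow> (real \<Rightarrow> real) \<Rightarrow> bool" where
  "tail_class \<gamma> \<tau> F \<longleftrightarrow>
     (\<exists>C>0. ((\<lambda>x. x powr (1 / \<gamma>) * (1 - F x)) \<longlongrightarrow> C) at_top) \<and>
     ((\<forall>\<^sub>F x in at_top. tail_delta \<gamma> F x > 0) \<or> (\<forall>\<^sub>F x in at_top. tail_delta \<gamma> F x < 0)) \<and>
     regularly_varying \<tau> (\<lambda>x. \<bar>tail_delta \<gamma> F x\<bar>)"

definition quantile :: "(real \<Rightarrow> real) \<Rightarrow> real \<Rightarrow> real" where
  "quantile F p = Inf {x. F x \<ge> p}"

definition tail_quantile :: "(real \<Rightarrow> real) \<Rightarrow> real \<Rightarrow> real" where
  "tail_quantile F y = quantile F (1 - 1 / y)"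

text \<open>The defining equation \<open>U y = C\<^bsup>\<gamma>\<^esup> y\<^bsup>\<gamma>\<^esup> (1 + a y)\<close>, solved for \<open>a y\<close>
  (see \<open>tail_a_eq\<close>).\<close>

definition tail_a :: "real \<Rightarrow> (real \<Rightarrow> real) \<Rightarrow> real \<Rightarrow> real" where
  "tail_a \<gamma> F y = tail_quantile F y / (tail_const \<gamma> F powr \<gamma> * y powr \<gamma>) - 1"

lemma tail_const_eqI:
  assumes "((\<lambda>x. x powr (1 / \<gamma>) * (1 - F x)) \<longlongrightarrow> C) at_top"
  shows "tail_const \<gamma> F = C"
  unfolding tail_const_def using assms by (intro tendsto_Lim) auto

lemma tail_const_pos: "tail_class \<gamma> \<tau> F \<Longrightarrow> tail_const \<gamma> F > 0"
  using tail_const_eqI unfolding tail_class_def by blast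

lemma tail_delta_eq:
  assumes "tail_class \<gamma> \<tau> F" "\<gamma> > 0" "x > 0"
  shows "1 - F x = tail_const \<gamma> F * x powr (- 1 / \<gamma>) * (1 + tail_delta \<gamma> F x / \<gamma>)"
  using tail_const_pos[OF assms(1)] assms(2,3)
  by (simp add: tail_delta_def powr_minus field_simps)

lemma tail_a_eq:
  assumes "tail_class \<gamma> \<tau> F" "y > 1"
  shows "tail_quantile F y = tail_const \<gamma> F powr \<gamma> * y powr \<gamma> * (1 + tail_a \<gamma> F y)"
  using tail_const_pos[OF assms(1)] assms(2) by (simp add: tail_a_def)

section \<open>Order statistics and the extended Pareto distribution\<close>

text \<open>The sample is \<open>X 1, \<dots>, X n\<close>, and \<open>order_stat X j n\<close> is its \<open>j\<close>-th smallest value,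
  \<open>1 \<le> j \<le> n\<close>.\<close>

definition order_stat :: "(nat \<Rightarrow> 'a \<Rightarrow> real) \<Rightarrow> nat \<Rightarrow> nat \<Rightarrow> 'a \<Rightarrow> real" where
  "order_stat X j n \<omega> = sort (map (\<lambda>i. X i \<omega>) [1..<Suc n]) ! (j - 1)"

definition epd_params :: "real \<Rightarrow> real \<Rightarrow> real \<Rightarrow> bool" where
  "epd_params \<gamma> \<delta> \<tau> \<longleftrightarrow> \<tau> < 0 \<and> 0 < \<gamma> \<and> \<delta> > max (-1) (1 / \<tau>)"

definition epd_cdf :: "real \<Rightarrow> real \<Rightarrow> real \<Rightarrow> real \<Rightarrow> real" where
  "epd_cdf \<gamma> \<delta> \<tau> y =
     (if y > 1 then 1 - (y * (1 + \<delta> - \<delta> * y powr \<tau>)) powr (- 1 / \<gamma>) else 0)"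

end

theory Submission
  imports Defs
begin

text \<open>
  Write \<open>V\<close> for the order statistic \<open>X\<^bsub>n-k:n\<^esub>\<close>. Dividing \<open>phat\<close> by \<open>p = 1 - F x\<close> and inserting
  \<open>1 - F y = C * y powr (- 1 / \<gamma>) * (1 + \<delta> y / \<gamma>)\<close> at \<open>y = x\<close> and \<open>y = V\<close> removes the constant \<open>C\<close> and leaves
  a product of factors, each \<open>1\<close> plus a term of order \<open>1 / sqrt k\<close>. To first order, \<open>sqrt k\<close> times the
  logarithm of the product is linear in \<open>(\<Gamma>, \<Delta>, Z)\<close>, except for the bias
  \<open>sqrt k * (\<delta> V * (x / V) powr \<tau> - \<delta> x) / \<gamma>\<close>. The bias vanishes because \<open>\<delta>\<close> is regularly
  varying of index \<open>\<tau>\<close>: it is the product of \<open>sqrt k * \<delta> V / \<gamma>\<close>, which stays bounded in probability, and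
  \<open>(x / V) powr \<tau> - \<delta> x / \<delta> V\<close>, which tends to 0 in probability.

  Two points need care. First, \<open>x / V\<close> is random and only converges, so regular variation is needed with
  a moving factor; this is the uniform convergence theorem (\<open>additive_uniform_convergence\<close>,
  \<open>regularly_varying_ratio_tendsto\<close>). Second, the boundedness of \<open>sqrt k * \<delta>\<close> near \<open>V\<close> comes from
  the condition on \<open>a\<close> by comparing \<open>F\<close> on both sides of the quantile (\<open>\<delta>_quantile_rate\<close>).

  The expansion itself is deterministic: \<open>epd_tail_expansion\<close> states it along an arbitrary filter.
  Probability enters only at the end. By tightness (\<open>conv_in_distr_imp_tight\<close>) and convergence of
  \<open>\<tau>hat\<close>, the triple is bounded and \<open>\<tau>hat\<close> is close to \<open>\<tau>\<close> with probability near 1, and on this event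
  the expansion holds uniformly. So the error of the linearization tends to 0 in probability, and
  Slutsky's theorem (\<open>Slutsky_null\<close>) finishes the proof.
\<close>

section \<open>Uniform convergence for regularly varying functions\<close>

text \<open>
  The uniform convergence theorem of Karamata in additive form. Averaging replaces Egorov's theorem:
  let \<open>J t\<close> be the integral of the truncated increments \<open>min 1 \<bar>h (t + s) - h t\<bar>\<close> over \<open>s \<in> [0, 2]\<close>. Dominated
  convergence gives \<open>J t \<longrightarrow> 0\<close>. For \<open>s \<in> [0, 1]\<close> the points \<open>t\<close> and \<open>t + s\<close> share
  an interval of length at least 1 ahead of them, and comparing both values of \<open>h\<close> with those on this
  interval bounds the truncated increment from \<open>t\<close> to \<open>t + s\<close> by \<open>J t + J (t + s)\<close>. Both
  terms are small beyond a point that does not depend on \<open>s\<close>.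
\<close>

lemma additive_uniform_convergence:
  fixes h :: "real \<Rightarrow> real"
  assumes meas [measurable]: "h \<in> borel_measurable borel"
    and lim: "\<And>s. ((\<lambda>t. h (t + s) - h t) \<longlongrightarrow> 0) at_top"
    and "e > 0"
  shows "\<forall>\<^sub>F t in at_top. \<forall>s. \<bar>s\<bar> \<le> 1 \<longrightarrow> \<bar>h (t + s) - h t\<bar> < e"
proof -
  define \<phi> where "\<phi> t s = min 1 \<bar>h (t + s) - h t\<bar>" for t s
  define J where "J t = (\<integral>s. indicator {0..2} s * \<phi> t s \<partial>lborel)" for t
  have \<phi>_meas [measurable]: "(\<lambda>s. \<phi> t s) \<in> borel_measurable borel" for t
    unfolding \<phi>_def by measurable
  have \<phi>_nonneg: "0 \<le> \<phi> t s" and \<phi>_le: "\<phi> t s \<le> 1" for t s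
    unfolding \<phi>_def by auto
  have int_bound: "integrable lborel (indicator {a..b} :: real \<Rightarrow> real)" for a b :: real
    by (intro integrable_real_indicator) (auto simp: emeasure_lborel_Icc_eq)
  have int: "integrable lborel (\<lambda>s. indicator {a..b} s * \<phi> t s)" for a b t
    by (rule Bochner_Integration.integrable_bound[OF int_bound[of a b]])
      (use \<phi>_nonneg \<phi>_le in \<open>auto simp: abs_mult mult_le_one split: split_indicator\<close>)
  have \<phi>_lim: "((\<lambda>t. \<phi> t s) \<longlongrightarrow> 0) at_top" for s
  proof -
    have "((\<lambda>t. min 1 \<bar>h (t + s) - h t\<bar>) \<longlongrightarrow> min 1 \<bar>0\<bar>) at_top"
      by (intro tendsto_min tendsto_const tendsto_rabs lim)
    then show ?thesis unfolding \<phi>_def by simp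
  qed
  have "(J \<longlongrightarrow> (\<integral>s. 0 \<partial>(lborel :: real measure))) at_top"
    unfolding J_def
  proof (rule integral_dominated_convergence_at_top[where w = "indicator {0..2}"])
    show "AE s in lborel. ((\<lambda>t. indicator {0..2} s * \<phi> t s) \<longlongrightarrow> 0) at_top"
      using \<phi>_lim by (auto intro!: tendsto_mult_right_zero)
    show "\<forall>\<^sub>F t in at_top. AE s in lborel. norm (indicator {0..2} s * \<phi> t s) \<le> indicator {0..2} s"
      using \<phi>_nonneg \<phi>_le by (auto simp: abs_mult split: split_indicator)
  qed (use int_bound in auto)
  then have J_lim: "(J \<longlongrightarrow> 0) at_top" by simp
  have step: "\<phi> t s \<le> J t + J (t + s)" if s: "0 \<le> s" "s \<le> 1" for t s
  proof -
    have "\<phi> t s \<le> (2 - s) * \<phi> t s"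
      using s \<phi>_nonneg[of t s] mult_right_mono[of 1 "2 - s" "\<phi> t s"] by simp
    also have "\<dots> = (\<integral>u. indicator {s..2} u * \<phi> t s \<partial>lborel)"
      using s by simp
    also have "\<dots> \<le> (\<integral>u. indicator {0..2} u * \<phi> t u + indicator {0..2} (u - s) * \<phi> (t + s) (u - s) \<partial>lborel)"
    proof (rule integral_mono)
      show "integrable lborel (\<lambda>u. indicator {s..2} u * \<phi> t s)"
        using int_bound by simp
      have "integrable lborel (\<lambda>u. indicator {0..2} (- s + 1 * u) * \<phi> (t + s) (- s + 1 * u))"
        by (rule lborel_integrable_real_affine) (use int in auto)
      then show "integrable lborel (\<lambda>u. indicator {0..2} u * \<phi> t u
          + indicator {0..2} (u - s) * \<phi> (t + s) (u - s))"
        using int by auto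
    next
      fix u
      have "\<phi> t s \<le> \<phi> t u + \<phi> (t + s) (u - s)" unfolding \<phi>_def by auto
      then show "indicator {s..2} u * \<phi> t s
          \<le> indicator {0..2} u * \<phi> t u + indicator {0..2} (u - s) * \<phi> (t + s) (u - s)"
        using s \<phi>_nonneg[of t u] \<phi>_nonneg[of "t + s" "u - s"]
        by (auto split: split_indicator)
    qed
    also have "\<dots> = J t + (\<integral>u. indicator {0..2} (u - s) * \<phi> (t + s) (u - s) \<partial>lborel)"
    proof -
      have "integrable lborel (\<lambda>u. indicator {0..2} (- s + 1 * u) * \<phi> (t + s) (- s + 1 * u))"
        by (rule lborel_integrable_real_affine) (use int in auto)
      then show ?thesis unfolding J_def using int by auto
    qed
    also have "(\<integral>u. indicator {0..2} (u - s) * \<phi> (t + s) (u - s) \<partial>lborel) = J (t + s)"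
      unfolding J_def
      by (subst (2) lborel_integral_real_affine[where c = 1 and t = "- s"]) auto
    finally show ?thesis .
  qed
  \<comment> \<open>Below the truncation level 1, the truncated increment is the increment itself.\<close>
  define e' where "e' = min 1 e / 2"
  have "e' > 0" using \<open>e > 0\<close> by (simp add: e'_def)
  then have "\<forall>\<^sub>F t in at_top. \<bar>J t\<bar> < e'"
    using J_lim tendstoD[of J 0 at_top e'] by (simp add: dist_real_def)
  then obtain T where T: "\<And>t. t \<ge> T \<Longrightarrow> \<bar>J t\<bar> < e'"
    by (auto simp: eventually_at_top_linorder)
  have close: "\<bar>h (t + s) - h t\<bar> < e" if "0 \<le> s" "s \<le> 1" "t \<ge> T" for t s
    using step[OF that(1,2), of t] T[of t] T[of "t + s"] that
    by (auto simp: e'_def \<phi>_def)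
  have "\<bar>h (t + s) - h t\<bar> < e" if "t \<ge> T + 1" "\<bar>s\<bar> \<le> 1" for t s
  proof (cases "s \<ge> 0")
    case True
    then show ?thesis using close that by auto
  next
    case False
    then show ?thesis using close[of "- s" "t + s"] that by (auto simp: abs_minus_commute)
  qed
  then show ?thesis unfolding eventually_at_top_linorder by blast
qed

text \<open>
  Both the argument \<open>u\<close> and the factor \<open>y\<close> move here. The definition of regular variation only
  covers a fixed factor; the moving one is absorbed by uniform convergence of
  \<open>ln (f (exp t)) - \<beta> * t\<close>. The filter is arbitrary so that \<open>u\<close> and \<open>y\<close> may depend on the sample.
\<close>

lemma regularly_varying_ratio_tendsto:
  fixes f :: "real \<Rightarrow> real" and u y :: "'i \<Rightarrow> real"
  assumes rv: "regularly_varying \<beta> f"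
    and u: "filterlim u at_top Fl" and y: "(y \<longlongrightarrow> c) Fl" and "c > 0"
  shows "((\<lambda>i. f (u i * y i) / f (u i)) \<longlongrightarrow> c powr \<beta>) Fl"
proof -
  from rv obtain A where pos: "\<And>x. x > A \<Longrightarrow> f x > 0"
    and meas: "f \<in> borel_measurable (restrict_space borel {A<..})"
    and lim: "\<And>x. x > 0 \<Longrightarrow> ((\<lambda>u. f (u * x) / f u) \<longlongrightarrow> x powr \<beta>) at_top"
    unfolding regularly_varying_def by auto
  \<comment> \<open>Regular variation constrains \<open>f\<close> only above some \<open>A\<close>; changing it below makes it globally measurable.\<close>
  define g where "g x = (if x \<in> {A<..} then f x else 1)" for x
  have [measurable]: "g \<in> borel_measurable borel"
    unfolding g_def using meas by (subst measurable_restrict_space_iff[symmetric]) auto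
  define h where "h t = ln (g (exp t)) - \<beta> * t" for t
  have hm: "h \<in> borel_measurable borel" unfolding h_def by measurable
  have h_eq: "h t = ln (f (exp t)) - \<beta> * t" if "exp t > A" for t
    using that by (simp add: h_def g_def)
  have h_lim: "((\<lambda>t. h (t + s) - h t) \<longlongrightarrow> 0) at_top" for s
  proof -
    have "((\<lambda>t. ln (f (exp t * exp s) / f (exp t)) - \<beta> * s)
        \<longlongrightarrow> ln (exp s powr \<beta>) - \<beta> * s) at_top"
      by (intro tendsto_diff tendsto_const tendsto_ln filterlim_compose[OF lim exp_at_top]) auto
    moreover have "\<forall>\<^sub>F t in at_top. ln (f (exp t * exp s) / f (exp t)) - \<beta> * s = h (t + s) - h t"
    proof -
      have "filterlim (\<lambda>t. s + t) at_top (at_top :: real filter)"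
        by (rule filterlim_tendsto_add_at_top[OF tendsto_const filterlim_ident])
      from filterlim_compose[OF exp_at_top this] exp_at_top
      have "\<forall>\<^sub>F t in at_top. exp t > A" "\<forall>\<^sub>F t in at_top. exp (t + s) > A"
        by (simp_all add: filterlim_at_top_dense add.commute)
      then show ?thesis
      proof eventually_elim
        case (elim t)
        then show ?case
          using pos[of "exp t"] pos[of "exp (t + s)"]
          by (simp add: h_eq exp_add ln_div algebra_simps)
      qed
    qed
    ultimately show ?thesis
      by (auto simp: ln_powr elim: Lim_transform_eventually)
  qed
  have y_pos: "\<forall>\<^sub>F i in Fl. y i > 0" using order_tendstoD(1)[OF y \<open>c > 0\<close>] .
  have u_large: "\<forall>\<^sub>F i in Fl. u i > B" for B
    using u by (simp add: filterlim_at_top_dense)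
  have uc: "filterlim (\<lambda>i. u i * c) at_top Fl"
    using filterlim_tendsto_pos_mult_at_top[OF tendsto_const \<open>c > 0\<close> u] by (simp add: mult.commute)
  have uy: "filterlim (\<lambda>i. u i * y i) at_top Fl"
    using filterlim_tendsto_pos_mult_at_top[OF y \<open>c > 0\<close> u] by (simp add: mult.commute)
  have s_lim: "((\<lambda>i. ln (y i / c)) \<longlongrightarrow> 0) Fl"
    using tendsto_ln[OF tendsto_divide[OF y tendsto_const, of c]] \<open>c > 0\<close> by simp
  have h_diff: "((\<lambda>i. h (ln (u i * c) + ln (y i / c)) - h (ln (u i * c))) \<longlongrightarrow> 0) Fl"
  proof (rule tendstoI)
    fix e :: real assume "e > 0"
    have "\<forall>\<^sub>F i in Fl. \<forall>s. \<bar>s\<bar> \<le> 1 \<longrightarrow> \<bar>h (ln (u i * c) + s) - h (ln (u i * c))\<bar> < e"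
      by (rule eventually_compose_filterlim[OF additive_uniform_convergence[OF hm h_lim \<open>e > 0\<close>]
            filterlim_compose[OF ln_at_top uc]])
    moreover have "\<forall>\<^sub>F i in Fl. \<bar>ln (y i / c)\<bar> < 1"
      using tendstoD[OF s_lim, of 1] by (simp add: dist_real_def)
    ultimately show "\<forall>\<^sub>F i in Fl. dist (h (ln (u i * c) + ln (y i / c)) - h (ln (u i * c))) 0 < e"
      by eventually_elim (simp add: dist_real_def)
  qed
  have "((\<lambda>i. exp (h (ln (u i * c) + ln (y i / c)) - h (ln (u i * c)) + \<beta> * ln (y i / c))
      * (f (u i * c) / f (u i))) \<longlongrightarrow> exp (0 + \<beta> * 0) * c powr \<beta>) Fl"
    by (intro tendsto_mult tendsto_exp tendsto_add h_diff s_lim tendsto_const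
        filterlim_compose[OF lim u] \<open>c > 0\<close>)
  moreover have "\<forall>\<^sub>F i in Fl. exp (h (ln (u i * c) + ln (y i / c)) - h (ln (u i * c)) + \<beta> * ln (y i / c))
      * (f (u i * c) / f (u i)) = f (u i * y i) / f (u i)"
    using y_pos u_large[of "max 0 A"] eventually_compose_filterlim[OF eventually_gt_at_top[of A] uc]
      eventually_compose_filterlim[OF eventually_gt_at_top[of A] uy]
  proof eventually_elim
    case (elim i)
    have *: "ln (u i * c) + ln (y i / c) = ln (u i * y i)"
      using elim \<open>c > 0\<close> by (simp add: ln_mult ln_div)
    have "h (ln (u i * y i)) - h (ln (u i * c)) + \<beta> * ln (y i / c)
        = ln (f (u i * y i)) - ln (f (u i * c))"
    proof -
      have "h (ln (u i * y i)) = ln (f (u i * y i)) - \<beta> * (ln (u i) + ln (y i))"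
        "h (ln (u i * c)) = ln (f (u i * c)) - \<beta> * (ln (u i) + ln c)"
        using elim \<open>c > 0\<close> h_eq[of "ln (u i * y i)"] h_eq[of "ln (u i * c)"]
        by (simp_all add: ln_mult exp_add)
      then show ?thesis using elim \<open>c > 0\<close> by (simp add: ln_div algebra_simps)
    qed
    then show ?case
      using pos[of "u i * y i"] pos[of "u i * c"] pos[of "u i"] elim
      by (simp add: * exp_diff)
  qed
  ultimately show ?thesis by (auto elim: Lim_transform_eventually)
qed

section \<open>Deterministic linearization\<close>

lemma bounded_imp_null_over_at_top:
  fixes w r :: "'i \<Rightarrow> real"
  assumes r: "filterlim r at_top Fl" and b: "\<forall>\<^sub>F i in Fl. \<bar>r i * w i\<bar> \<le> B"
  shows "(w \<longlongrightarrow> 0) Fl"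
proof -
  have "((\<lambda>i. inverse (r i) * (r i * w i)) \<longlongrightarrow> 0) Fl"
    by (rule lim_null_mult_right_bounded[where B = B])
      (use b in \<open>auto intro: tendsto_inverse_0_at_top r\<close>)
  moreover have "\<forall>\<^sub>F i in Fl. inverse (r i) * (r i * w i) = w i"
    using eventually_compose_filterlim[OF eventually_gt_at_top[of 0] r]
    by eventually_elim auto
  ultimately show ?thesis by (auto elim: Lim_transform_eventually)
qed

text \<open>
  The delta method, stated for deterministic families: \<open>w\<close> is of order \<open>1 / r\<close>, so a nonlinear
  function of \<open>w\<close> agrees with its linearization up to \<open>o(1 / r)\<close>.
\<close>

lemma scaled_increment:
  fixes w r :: "'i \<Rightarrow> real" and f :: "real \<Rightarrow> real"
  assumes r: "filterlim r at_top Fl" and b: "\<forall>\<^sub>F i in Fl. \<bar>r i * w i\<bar> \<le> B"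
    and f: "(f has_field_derivative D) (at 0)"
  shows "((\<lambda>i. r i * (f (w i) - f 0) - D * (r i * w i)) \<longlongrightarrow> 0) Fl"
proof -
  obtain g where g: "\<And>z. f z - f 0 = g z * z" "isCont g 0" "g 0 = D"
    using f by (auto simp: CARAT_DERIV)
  have "((\<lambda>i. g (w i) - D) \<longlongrightarrow> D - D) Fl"
    using isCont_tendsto_compose[OF g(2) bounded_imp_null_over_at_top[OF r b]] g(3)
    by (intro tendsto_diff tendsto_const) auto
  then have "((\<lambda>i. (g (w i) - D) * (r i * w i)) \<longlongrightarrow> 0) Fl"
    by (intro lim_null_mult_right_bounded[where B = B]) (use b in auto)
  then show ?thesis by (simp add: g(1) algebra_simps)
qed

lemma filterlim_powr_at_top:
  fixes c :: real
  assumes "c > 0"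
  shows "filterlim (\<lambda>x. x powr c) at_top at_top"
proof -
  have "filterlim (\<lambda>x. exp (c * ln x)) at_top at_top"
    by (intro filterlim_compose[OF exp_at_top] filterlim_tendsto_pos_mult_at_top[OF tendsto_const assms]
        ln_at_top)
  moreover have "\<forall>\<^sub>F x in at_top. exp (c * ln x) = x powr c"
    using eventually_gt_at_top[of 0] by eventually_elim (simp add: powr_def)
  ultimately show ?thesis using filterlim_cong[OF refl refl] by fastforce
qed

section \<open>Tail levels and quantiles\<close>

locale heavy_tail =
  fixes \<gamma> \<tau> :: real and F :: "real \<Rightarrow> real"
  assumes \<gamma>_pos: "\<gamma> > 0" and \<tau>_neg: "\<tau> < 0"
    and tail: "tail_class \<gamma> \<tau> F" and mono: "mono F" and F_0: "F 0 = 0"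
begin

abbreviation "C \<equiv> tail_const \<gamma> F"
abbreviation "\<delta> \<equiv> tail_delta \<gamma> F"

lemma C_pos: "C > 0"
  using tail_const_pos[OF tail] .

lemma tail_limit: "((\<lambda>x. x powr (1 / \<gamma>) * (1 - F x)) \<longlongrightarrow> C) at_top"
  using tail tail_const_eqI unfolding tail_class_def by blast

lemma \<delta>_null: "(\<delta> \<longlongrightarrow> 0) at_top"
proof -
  have "((\<lambda>x. \<gamma> * (x powr (1 / \<gamma>) * (1 - F x) / C - 1)) \<longlongrightarrow> \<gamma> * (C / C - 1)) at_top"
    using C_pos by (intro tendsto_intros tail_limit) auto
  then show ?thesis using C_pos by (simp add: tail_delta_def[abs_def])
qed

lemma survival_pos: "F x < 1"
proof -
  have "\<forall>\<^sub>F y in at_top. y \<ge> x \<and> y powr (1 / \<gamma>) * (1 - F y) > 0"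
    by (intro eventually_conj eventually_ge_at_top order_tendstoD(1)[OF tail_limit C_pos])
  then obtain y where "y \<ge> x" "y powr (1 / \<gamma>) * (1 - F y) > 0"
    by (auto simp: eventually_at_top_linorder)
  then have "F x \<le> F y" "F y < 1"
    using monoD[OF mono] by (auto simp: zero_less_mult_iff)
  then show ?thesis by simp
qed

lemma F_tends_1: "(F \<longlongrightarrow> 1) at_top"
proof -
  have "((\<lambda>x. x powr (- (1 / \<gamma>)) * (x powr (1 / \<gamma>) * (1 - F x))) \<longlongrightarrow> 0 * C) at_top"
    using \<gamma>_pos by (intro tendsto_mult tail_limit tendsto_neg_powr filterlim_ident) auto
  moreover have "\<forall>\<^sub>F x in at_top. x powr (- (1 / \<gamma>)) * (x powr (1 / \<gamma>) * (1 - F x)) = 1 - F x"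
    using eventually_gt_at_top[of 0]
    by eventually_elim (simp add: mult.assoc[symmetric] powr_add[symmetric])
  ultimately have "((\<lambda>x. 1 - F x) \<longlongrightarrow> 0) at_top"
    by (auto elim: Lim_transform_eventually)
  from tendsto_diff[OF tendsto_const[of 1] this] show ?thesis by simp
qed

text \<open>
  Regular variation is assumed of the absolute value; the eventually constant sign of \<open>\<delta>\<close>
  removes the bars.
\<close>

lemma \<delta>_ratio_tendsto:
  assumes "filterlim u at_top Fl" and "(y \<longlongrightarrow> c) Fl" and "c > 0"
  shows "((\<lambda>i. \<delta> (u i * y i) / \<delta> (u i)) \<longlongrightarrow> c powr \<tau>) Fl"
proof -
  have rv: "regularly_varying \<tau> (\<lambda>x. \<bar>\<delta> x\<bar>)"
    and sign: "(\<forall>\<^sub>F x in at_top. \<delta> x > 0) \<or> (\<forall>\<^sub>F x in at_top. \<delta> x < 0)"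
    using tail unfolding tail_class_def by auto
  have uy: "filterlim (\<lambda>i. u i * y i) at_top Fl"
    using filterlim_tendsto_pos_mult_at_top[OF assms(2,3,1)] by (simp add: mult.commute)
  have "\<forall>\<^sub>F i in Fl. \<bar>\<delta> (u i * y i)\<bar> / \<bar>\<delta> (u i)\<bar> = \<delta> (u i * y i) / \<delta> (u i)"
    using sign
  proof
    assume s: "\<forall>\<^sub>F x in at_top. \<delta> x > 0"
    show ?thesis
      using eventually_compose_filterlim[OF s assms(1)] eventually_compose_filterlim[OF s uy]
      by eventually_elim simp
  next
    assume s: "\<forall>\<^sub>F x in at_top. \<delta> x < 0"
    show ?thesis
      using eventually_compose_filterlim[OF s assms(1)] eventually_compose_filterlim[OF s uy]
      by eventually_elim simp
  qed
  with regularly_varying_ratio_tendsto[OF rv assms] show ?thesis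
    by (rule Lim_transform_eventually)
qed

lemma \<delta>_nonzero: "\<forall>\<^sub>F x in at_top. \<delta> x \<noteq> 0"
proof -
  have "(\<forall>\<^sub>F x in at_top. \<delta> x > 0) \<or> (\<forall>\<^sub>F x in at_top. \<delta> x < 0)"
    using tail unfolding tail_class_def by auto
  then show ?thesis by (auto elim: eventually_mono)
qed

text \<open>
  In the next two lemmas the tail probability at \<open>v\<close> is about \<open>c / m\<close>. Since \<open>F\<close> never reaches 1, such a
  level must exceed every constant, and inverting \<open>1 - F v \<sim> C * v powr (- 1 / \<gamma>)\<close> locates it. They are
  applied to the random threshold (\<open>c = 1\<close>) and to the target level (\<open>c = q\<close>).
\<close>

lemma tail_level_at_top:
  assumes m: "filterlim m at_top Fl" and v: "((\<lambda>i. m i * (1 - F (v i))) \<longlongrightarrow> c) Fl"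
  shows "filterlim v at_top Fl"
  unfolding filterlim_at_top_dense
proof
  fix A
  have "((\<lambda>i. inverse (m i) * (m i * (1 - F (v i)))) \<longlongrightarrow> 0 * c) Fl"
    by (intro tendsto_mult tendsto_inverse_0_at_top m v)
  then have "\<forall>\<^sub>F i in Fl. inverse (m i) * (m i * (1 - F (v i))) < 1 - F A"
    using survival_pos[of A] by (intro order_tendstoD(2)) auto
  with eventually_compose_filterlim[OF eventually_gt_at_top[of 0] m]
  show "\<forall>\<^sub>F i in Fl. A < v i"
  proof eventually_elim
    case (elim i)
    then have "F A < F (v i)" by (simp add: mult.assoc[symmetric])
    then show ?case using monoD[OF mono, of "v i" A] by (meson not_le)
  qed
qed

lemma tail_level_asymp:
  assumes m: "filterlim m at_top Fl" and v: "((\<lambda>i. m i * (1 - F (v i))) \<longlongrightarrow> c) Fl" and "c > 0"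
  shows "((\<lambda>i. v i / (C * m i) powr \<gamma>) \<longlongrightarrow> c powr (- \<gamma>)) Fl"
proof -
  have v_top: "filterlim v at_top Fl" by (rule tail_level_at_top[OF m v])
  have "((\<lambda>i. (v i powr (1 / \<gamma>) * (1 - F (v i)) / (m i * (1 - F (v i))) / C) powr \<gamma>)
      \<longlongrightarrow> (C / c / C) powr \<gamma>) Fl"
    using \<open>c > 0\<close> C_pos
    by (intro tendsto_intros filterlim_compose[OF tail_limit v_top] v) auto
  moreover have "\<forall>\<^sub>F i in Fl. (v i powr (1 / \<gamma>) * (1 - F (v i)) / (m i * (1 - F (v i))) / C) powr \<gamma>
      = v i / (C * m i) powr \<gamma>"
    using eventually_compose_filterlim[OF eventually_gt_at_top[of 0] m]
      eventually_compose_filterlim[OF eventually_gt_at_top[of 0] v_top]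
  proof eventually_elim
    case (elim i)
    then show ?case
      using survival_pos[of "v i"] C_pos \<gamma>_pos
      by (simp add: powr_divide powr_mult powr_powr)
  qed
  ultimately show ?thesis
    using C_pos \<open>c > 0\<close>
    by (auto simp: powr_minus powr_divide inverse_eq_divide elim: Lim_transform_eventually)
qed

text \<open>
  As \<open>F\<close> may jump, \<open>1 - F (U y) = 1 / y\<close> can fail at the quantile \<open>U y\<close> itself; it holds as a pair of
  inequalities on the two sides.
\<close>

lemma tail_quantile_bracket:
  assumes "y > 1"
  shows "z > tail_quantile F y \<Longrightarrow> y * (1 - F z) \<le> 1"
    and "z < tail_quantile F y \<Longrightarrow> y * (1 - F z) \<ge> 1"
proof -
  let ?S = "{x. F x \<ge> 1 - 1 / y}"
  have Q: "tail_quantile F y = Inf ?S" by (simp add: tail_quantile_def quantile_def)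
  have bdd: "bdd_below ?S"
  proof (rule bdd_belowI)
    fix x assume "x \<in> ?S"
    then have "F x > F 0" using assms F_0 by auto (smt (verit) divide_less_eq_1)
    then show "0 \<le> x" using monoD[OF mono, of x 0] by linarith
  qed
  have "\<forall>\<^sub>F x in at_top. F x > 1 - 1 / y"
    using assms by (intro order_tendstoD(1)[OF F_tends_1]) auto
  then have ne: "?S \<noteq> {}" by (auto simp: eventually_at_top_linorder intro: less_imp_le)
  {
    assume "z > tail_quantile F y"
    then obtain x where "F x \<ge> 1 - 1 / y" "x < z"
      using cInf_less_iff[OF ne bdd] by (auto simp: Q)
    then have "F z \<ge> 1 - 1 / y" using monoD[OF mono, of x z] by simp
    then show "y * (1 - F z) \<le> 1" using assms by (simp add: field_simps)
  }
  {
    assume "z < tail_quantile F y"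
    then have "\<not> F z \<ge> 1 - 1 / y" using cInf_lower[OF _ bdd, of z] by (auto simp: Q)
    then show "y * (1 - F z) \<ge> 1" using assms by (simp add: field_simps)
  }
qed

lemma tail_quantile_asymp:
  assumes m: "filterlim m at_top Fl" and a: "((\<lambda>i. tail_a \<gamma> F (m i)) \<longlongrightarrow> 0) Fl"
  shows "((\<lambda>i. tail_quantile F (m i) / (C * m i) powr \<gamma>) \<longlongrightarrow> 1) Fl"
proof -
  have "((\<lambda>i. 1 + tail_a \<gamma> F (m i)) \<longlongrightarrow> 1 + 0) Fl" by (intro tendsto_intros a)
  moreover have "\<forall>\<^sub>F i in Fl. 1 + tail_a \<gamma> F (m i) = tail_quantile F (m i) / (C * m i) powr \<gamma>"
    using eventually_compose_filterlim[OF eventually_gt_at_top[of 1] m]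
    by eventually_elim (use C_pos in \<open>simp add: tail_a_def powr_mult\<close>)
  ultimately show ?thesis by (auto elim: Lim_transform_eventually)
qed

lemma tail_quantile_at_top:
  assumes m: "filterlim m at_top Fl" and a: "((\<lambda>i. tail_a \<gamma> F (m i)) \<longlongrightarrow> 0) Fl"
  shows "filterlim (\<lambda>i. tail_quantile F (m i)) at_top Fl"
proof -
  let ?b = "\<lambda>i. (C * m i) powr \<gamma>"
  have "filterlim ?b at_top Fl"
    by (intro filterlim_compose[OF filterlim_powr_at_top[OF \<gamma>_pos]]
        filterlim_tendsto_pos_mult_at_top[OF tendsto_const C_pos m])
  from filterlim_tendsto_pos_mult_at_top[OF tail_quantile_asymp[OF m a] zero_less_one this]
  have "filterlim (\<lambda>i. tail_quantile F (m i) / ?b i * ?b i) at_top Fl" .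
  moreover have "\<forall>\<^sub>F i in Fl. tail_quantile F (m i) / ?b i * ?b i = tail_quantile F (m i)"
    using eventually_compose_filterlim[OF eventually_gt_at_top[of 0] m]
    by eventually_elim (use C_pos in simp)
  ultimately show ?thesis using filterlim_cong[OF refl refl] by fastforce
qed

text \<open>
  This turns the rate condition on \<open>a\<close>, which is about the quantile function, into one on \<open>\<delta>\<close>, which is
  about the distribution function. Evaluating \<open>1 - F\<close> slightly above (below) the quantile, at relative
  distance \<open>1 / r\<close>, gives an upper (lower) bound of order \<open>1 / r\<close> for \<open>\<delta>\<close> there. Only one side is needed,
  since \<open>\<delta>\<close> has constant sign: above the quantile if \<open>\<delta> > 0\<close>, below if \<open>\<delta> < 0\<close>. Regular
  variation carries the bound back to the quantile.
\<close>

lemma \<delta>_quantile_rate: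
  assumes m: "filterlim m at_top Fl" and r: "filterlim r at_top Fl"
    and a: "\<forall>\<^sub>F i in Fl. \<bar>r i * tail_a \<gamma> F (m i)\<bar> \<le> A"
  shows "\<exists>B. \<forall>\<^sub>F i in Fl. \<bar>r i * \<delta> (tail_quantile F (m i))\<bar> \<le> B"
proof -
  define u where "u i = tail_quantile F (m i)" for i
  \<comment> \<open>The point \<open>v s\<close> lies at relative distance \<open>s / r\<close> from the quantile, \<open>1 + w s\<close> is its ratio to
      \<open>(C * m) powr \<gamma>\<close>, and \<open>1 + e s\<close> is \<open>1 / m\<close> divided by the pure Pareto tail at \<open>v s\<close>.\<close>
  define w where "w s i = (1 + tail_a \<gamma> F (m i)) * (1 + s / r i) - 1" for s i
  define e where "e s i = (1 + w s i) powr (1 / \<gamma>) - 1" for s i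
  define v where "v s i = u i * (1 + s / r i)" for s i
  have m1: "\<forall>\<^sub>F i in Fl. m i > 1" and r1: "\<forall>\<^sub>F i in Fl. r i > 1"
    using eventually_compose_filterlim[OF eventually_gt_at_top[of 1]] m r by auto
  have a_null: "((\<lambda>i. tail_a \<gamma> F (m i)) \<longlongrightarrow> 0) Fl"
    by (rule bounded_imp_null_over_at_top[OF r a])
  have u_top: "filterlim u at_top Fl"
    unfolding u_def by (rule tail_quantile_at_top[OF m a_null])
  have s_null: "((\<lambda>i. s / r i) \<longlongrightarrow> 0) Fl" for s
    by (intro tendsto_divide_0[OF tendsto_const] filterlim_at_top_imp_at_infinity r)
  have v_top: "filterlim (v s) at_top Fl" for s
    using filterlim_tendsto_pos_mult_at_top[OF tendsto_add[OF tendsto_const[of 1] s_null[of s]] _ u_top]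
    by (simp add: v_def[abs_def] mult.commute)
  have e_bound: "\<exists>B. \<forall>\<^sub>F i in Fl. \<bar>r i * e s i\<bar> \<le> B" for s
  proof -
    have w_bound: "\<forall>\<^sub>F i in Fl. \<bar>r i * w s i\<bar> \<le> A + \<bar>s\<bar> * 2"
      using a r1 tendstoD[OF a_null zero_less_one]
    proof eventually_elim
      case (elim i)
      have "r i * w s i = r i * tail_a \<gamma> F (m i) + s * (1 + tail_a \<gamma> F (m i))"
        using elim by (simp add: w_def field_simps)
      also have "\<bar>\<dots>\<bar> \<le> A + \<bar>s\<bar> * 2"
        using elim by (intro order_trans[OF abs_triangle_ineq] add_mono)
          (auto simp: abs_mult dist_real_def intro!: mult_left_mono)
      finally show ?case .
    qed
    have "((\<lambda>z. (1 + z) powr (1 / \<gamma>)) has_field_derivative 1 / \<gamma>) (at 0)"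
      by (rule derivative_eq_intros | simp)+
    from scaled_increment[OF r w_bound this]
    have "((\<lambda>i. r i * e s i - 1 / \<gamma> * (r i * w s i)) \<longlongrightarrow> 0) Fl"
      by (simp add: e_def)
    from tendstoD[OF this zero_less_one] w_bound
    have "\<forall>\<^sub>F i in Fl. \<bar>r i * e s i\<bar> \<le> 1 + 1 / \<gamma> * (A + \<bar>s\<bar> * 2)"
    proof eventually_elim
      case (elim i)
      have "\<bar>1 / \<gamma> * (r i * w s i)\<bar> \<le> 1 / \<gamma> * (A + \<bar>s\<bar> * 2)"
        using elim \<gamma>_pos unfolding abs_mult by (intro mult_mono) auto
      then show ?case using elim(1) unfolding dist_real_def by linarith
    qed
    then show ?thesis by blast
  qed
  have rel: "\<forall>\<^sub>F i in Fl. m i * (1 - F (v s i)) * (1 + e s i) = 1 + \<delta> (v s i) / \<gamma>" for s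
    using m1 eventually_compose_filterlim[OF eventually_gt_at_top[of 0] v_top[of s]]
  proof eventually_elim
    case (elim i)
    have v_eq: "v s i = (C * m i) powr \<gamma> * (1 + w s i)"
      using elim C_pos by (simp add: v_def u_def w_def tail_a_def powr_mult)
    then have "1 + w s i > 0" using elim C_pos by (simp add: zero_less_mult_iff)
    then have "v s i powr (- 1 / \<gamma>) = (1 + w s i) powr (- 1 / \<gamma>) / (C * m i)"
      using elim C_pos \<gamma>_pos unfolding v_eq
      by (simp add: powr_mult powr_powr powr_minus_divide)
    moreover have "(1 + w s i) powr (- 1 / \<gamma>) * (1 + w s i) powr (1 / \<gamma>) = 1"
      using \<open>1 + w s i > 0\<close> by (simp add: powr_minus)
    ultimately show ?case
      using tail_delta_eq[OF tail \<gamma>_pos elim(2)] elim C_pos by (simp add: e_def)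
  qed
  have transfer: ?thesis if "\<forall>\<^sub>F i in Fl. \<bar>r i * \<delta> (v s i)\<bar> \<le> B" for s B
  proof -
    have "((\<lambda>i. \<delta> (v s i) / \<delta> (u i)) \<longlongrightarrow> 1 powr \<tau>) Fl"
      unfolding v_def
      using tendsto_add[OF tendsto_const[of 1] s_null[of s]] by (intro \<delta>_ratio_tendsto u_top) auto
    then have "\<forall>\<^sub>F i in Fl. \<delta> (v s i) / \<delta> (u i) > 1 / 2" by (intro order_tendstoD(1)) auto
    with that r1 eventually_compose_filterlim[OF \<delta>_nonzero u_top]
    have "\<forall>\<^sub>F i in Fl. \<bar>r i * \<delta> (u i)\<bar> \<le> 2 * B"
    proof eventually_elim
      case (elim i)
      have "\<bar>\<delta> (v s i)\<bar> / \<bar>\<delta> (u i)\<bar> > 1 / 2" using elim by (metis abs_divide abs_ge_self less_le_trans)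
      then have "\<bar>\<delta> (u i)\<bar> \<le> 2 * \<bar>\<delta> (v s i)\<bar>" using elim by (simp add: field_simps)
      then have "\<bar>r i * \<delta> (u i)\<bar> \<le> 2 * \<bar>r i * \<delta> (v s i)\<bar>"
        using elim by (simp add: abs_mult mult_left_mono)
      then show ?case using elim by simp
    qed
    then show ?thesis unfolding u_def by blast
  qed
  have u0: "\<forall>\<^sub>F i in Fl. u i > 0" by (rule eventually_compose_filterlim[OF eventually_gt_at_top u_top])
  have e_pos: "\<forall>\<^sub>F i in Fl. 1 + e s i > 0" for s
  proof -
    obtain B where "\<forall>\<^sub>F i in Fl. \<bar>r i * e s i\<bar> \<le> B" using e_bound by blast
    from order_tendstoD(1)[OF bounded_imp_null_over_at_top[OF r this], of "-1"]
    show ?thesis by (auto elim: eventually_mono)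
  qed
  have "(\<forall>\<^sub>F x in at_top. \<delta> x > 0) \<or> (\<forall>\<^sub>F x in at_top. \<delta> x < 0)"
    using tail unfolding tail_class_def by auto
  then show ?thesis
  proof
    assume s: "\<forall>\<^sub>F x in at_top. \<delta> x > 0"
    obtain B where B: "\<forall>\<^sub>F i in Fl. \<bar>r i * e 1 i\<bar> \<le> B" using e_bound by blast
    have "\<forall>\<^sub>F i in Fl. \<bar>r i * \<delta> (v 1 i)\<bar> \<le> \<gamma> * B"
      using B rel[of 1] m1 r1 u0 e_pos[of 1] eventually_compose_filterlim[OF s v_top[of 1]]
    proof eventually_elim
      case (elim i)
      have "v 1 i > u i" using elim by (simp add: v_def field_simps)
      then have "m i * (1 - F (v 1 i)) \<le> 1"
        using elim by (intro tail_quantile_bracket) (auto simp: u_def)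
      then have "1 + \<delta> (v 1 i) / \<gamma> \<le> 1 + e 1 i"
        using elim mult_right_mono[of _ 1 "1 + e 1 i"] by fastforce
      then have "\<delta> (v 1 i) \<le> \<gamma> * e 1 i" using \<gamma>_pos by (simp add: field_simps)
      then have "r i * \<delta> (v 1 i) \<le> r i * (\<gamma> * e 1 i)" using elim by (intro mult_left_mono) auto
      also have "\<dots> = \<gamma> * (r i * e 1 i)" by simp
      also have "\<dots> \<le> \<gamma> * B" using elim \<gamma>_pos by (intro mult_left_mono) auto
      finally show ?case using elim by (simp add: abs_mult)
    qed
    then show ?thesis by (rule transfer)
  next
    assume s: "\<forall>\<^sub>F x in at_top. \<delta> x < 0"
    obtain B where B: "\<forall>\<^sub>F i in Fl. \<bar>r i * e (-1) i\<bar> \<le> B" using e_bound by blast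
    have "\<forall>\<^sub>F i in Fl. \<bar>r i * \<delta> (v (-1) i)\<bar> \<le> \<gamma> * B"
      using B rel[of "-1"] m1 r1 u0 e_pos[of "-1"] eventually_compose_filterlim[OF s v_top[of "-1"]]
    proof eventually_elim
      case (elim i)
      have "v (-1) i < u i" using elim by (simp add: v_def field_simps)
      then have "m i * (1 - F (v (-1) i)) \<ge> 1"
        using elim by (intro tail_quantile_bracket) (auto simp: u_def)
      then have "1 + \<delta> (v (-1) i) / \<gamma> \<ge> 1 + e (-1) i"
        using elim mult_right_mono[of 1 _ "1 + e (-1) i"] by fastforce
      then have "- \<delta> (v (-1) i) \<le> \<gamma> * - e (-1) i" using \<gamma>_pos by (simp add: field_simps)
      then have "r i * - \<delta> (v (-1) i) \<le> r i * (\<gamma> * - e (-1) i)" using elim by (intro mult_left_mono) auto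
      also have "\<dots> = \<gamma> * (- (r i * e (-1) i))" by simp
      also have "\<dots> \<le> \<gamma> * B" using elim \<gamma>_pos by (intro mult_left_mono) auto
      finally show ?case using elim by (simp add: abs_mult)
    qed
    then show ?thesis by (rule transfer)
  qed
qed

section \<open>First-order expansion of the tail estimator\<close>

text \<open>
  The theorem without probability. Here \<open>m\<close> stands for \<open>n / k\<close>, \<open>r\<close> for the square root of \<open>k\<close>, \<open>v\<close> for the
  random threshold, and \<open>g\<close>, \<open>d\<close>, \<open>th\<close> for the rescaled errors of the first two estimators and the value
  of the third. With \<open>Y = x / v\<close>, \<open>\<gamma>' = \<gamma> + g / r\<close> and \<open>\<delta>' = \<delta> v + d / r\<close> the ratio of the estimate to
  \<open>1 - F x\<close> is exactly
  \<open>Y powr (1 / \<gamma> - 1 / \<gamma>') * (1 + \<delta> v / \<gamma>) * (1 + \<delta>' * (1 - Y powr th)) powr (- 1 / \<gamma>')\<close> divided by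
  \<open>m * (1 - F v) * (1 + \<delta> x / \<gamma>)\<close>,
  and \<open>Y\<close> tends to \<open>q powr (- \<gamma>)\<close>. Each factor is \<open>1 + O(1 / r)\<close>, so the logarithm is expanded term by term.
  The error term \<open>r * \<delta> v\<close>, which need not vanish, drops out because
  the difference of \<open>r * \<delta> v - r * \<delta> x\<close> and \<open>r * \<delta> v * (1 - Y powr th)\<close> tends to 0:
  regular variation makes \<open>\<delta> x / \<delta> v\<close> and \<open>Y powr th\<close> both tend to \<open>q powr (- (\<gamma> * \<tau>))\<close>.
\<close>

lemma epd_tail_expansion:
  fixes m r v x g d th :: "'i \<Rightarrow> real"
  assumes m: "filterlim m at_top Fl" and r: "filterlim r at_top Fl"
    and a: "\<forall>\<^sub>F i in Fl. \<bar>r i * tail_a \<gamma> F (m i)\<bar> \<le> A"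
    and x: "((\<lambda>i. m i * (1 - F (x i))) \<longlongrightarrow> q) Fl" and q: "0 < q" "q < 1"
    and z: "\<forall>\<^sub>F i in Fl. \<bar>r i * (m i * (1 - F (v i)) - 1)\<bar> \<le> B"
    and g: "\<forall>\<^sub>F i in Fl. \<bar>g i\<bar> \<le> B" and d: "\<forall>\<^sub>F i in Fl. \<bar>d i\<bar> \<le> B"
    and th: "(th \<longlongrightarrow> \<tau>) Fl"
  shows "\<forall>\<^sub>F i in Fl. epd_params (\<gamma> + g i / r i) (\<delta> (v i) + d i / r i) (th i)" (is ?params)
    and "((\<lambda>i. r i * (1 / m i * (1 - epd_cdf (\<gamma> + g i / r i) (\<delta> (v i) + d i / r i) (th i) (x i / v i))
            / (1 - F (x i)) - 1)
          - (- (1 / \<gamma>) * g i * ln q - (1 / \<gamma>) * d i * (1 - q powr (- (\<gamma> * \<tau>)))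
             - r i * (m i * (1 - F (v i)) - 1))) \<longlongrightarrow> 0) Fl" (is ?expansion)
proof -
  define u where "u i = tail_quantile F (m i)" for i
  define b where "b i = (C * m i) powr \<gamma>" for i
  define Q where "Q = q powr (- \<gamma>)"
  define q' where "q' = q powr (- (\<gamma> * \<tau>))"
  define \<gamma>' where "\<gamma>' i = \<gamma> + g i / r i" for i
  define \<delta>' where "\<delta>' i = \<delta> (v i) + d i / r i" for i
  define Y where "Y i = x i / v i" for i
  define w1 where "w1 i = m i * (1 - F (v i)) - 1" for i
  define w2 where "w2 i = \<delta> (v i) / \<gamma>" for i
  define w3 where "w3 i = \<delta> (x i) / \<gamma>" for i
  define w4 where "w4 i = \<delta>' i * (1 - Y i powr th i)" for i

  have m0: "\<forall>\<^sub>F i in Fl. m i > 0" and r0: "\<forall>\<^sub>F i in Fl. r i > 0"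
    using eventually_compose_filterlim[OF eventually_gt_at_top[of 0]] m r by auto
  have b0: "\<forall>\<^sub>F i in Fl. b i > 0"
    using m0 by eventually_elim (use C_pos in \<open>simp add: b_def\<close>)
  have Q1: "Q > 1" using powr_less_mono2[of \<gamma> q 1] q \<gamma>_pos by (simp add: Q_def powr_minus one_less_inverse_iff)
  have q'_eq: "Q powr \<tau> = q'" by (simp add: Q_def q'_def powr_powr)
  have r_inv: "((\<lambda>i. inverse (r i)) \<longlongrightarrow> 0) Fl" by (rule tendsto_inverse_0_at_top[OF r])
  have a_null: "((\<lambda>i. tail_a \<gamma> F (m i)) \<longlongrightarrow> 0) Fl" by (rule bounded_imp_null_over_at_top[OF r a])

  \<comment> \<open>The levels \<open>v\<close>, \<open>x\<close> and \<open>u\<close> are all asymptotically proportional to \<open>b\<close>.\<close>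
  have w1_null: "(w1 \<longlongrightarrow> 0) Fl"
    unfolding w1_def by (rule bounded_imp_null_over_at_top[OF r z])
  have v_level: "((\<lambda>i. m i * (1 - F (v i))) \<longlongrightarrow> 1) Fl"
    using tendsto_add[OF w1_null tendsto_const[of 1]] by (simp add: w1_def)
  have v_top: "filterlim v at_top Fl" by (rule tail_level_at_top[OF m v_level])
  have x_top: "filterlim x at_top Fl" by (rule tail_level_at_top[OF m x])
  have v0: "\<forall>\<^sub>F i in Fl. v i > 0" and x0: "\<forall>\<^sub>F i in Fl. x i > 0"
    using eventually_compose_filterlim[OF eventually_gt_at_top[of 0]] v_top x_top by auto
  have vb: "((\<lambda>i. v i / b i) \<longlongrightarrow> 1) Fl"
    using tail_level_asymp[OF m v_level] by (simp add: b_def)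
  have xb: "((\<lambda>i. x i / b i) \<longlongrightarrow> Q) Fl"
    using tail_level_asymp[OF m x q(1)] by (simp add: b_def Q_def)
  have ub: "((\<lambda>i. u i / b i) \<longlongrightarrow> 1) Fl"
    using tail_quantile_asymp[OF m a_null] by (simp add: b_def u_def)
  have u_top: "filterlim u at_top Fl"
    unfolding u_def by (rule tail_quantile_at_top[OF m a_null])
  have u0: "\<forall>\<^sub>F i in Fl. u i > 0"
    by (rule eventually_compose_filterlim[OF eventually_gt_at_top u_top])
  have quot: "((\<lambda>i. y i / y' i) \<longlongrightarrow> c / c') Fl"
    if "((\<lambda>i. y i / b i) \<longlongrightarrow> c) Fl" "((\<lambda>i. y' i / b i) \<longlongrightarrow> c') Fl" "c' \<noteq> 0" for y y' c c'
  proof -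
    have "((\<lambda>i. (y i / b i) / (y' i / b i)) \<longlongrightarrow> c / c') Fl" by (intro tendsto_intros that)
    moreover have "\<forall>\<^sub>F i in Fl. (y i / b i) / (y' i / b i) = y i / y' i"
      using b0 by eventually_elim simp
    ultimately show ?thesis by (rule Lim_transform_eventually)
  qed
  have Y_lim: "(Y \<longlongrightarrow> Q) Fl" using quot[OF xb vb] by (simp add: Y_def[abs_def])
  have Y1: "\<forall>\<^sub>F i in Fl. Y i > 1" by (rule order_tendstoD(1)[OF Y_lim Q1])

  \<comment> \<open>The rate is known at the quantile \<open>u\<close> only; regular variation transfers it to \<open>v\<close> and \<open>x\<close>.\<close>
  obtain K where K: "\<forall>\<^sub>F i in Fl. \<bar>r i * \<delta> (u i)\<bar> \<le> K"
    using \<delta>_quantile_rate[OF m r a] by (auto simp: u_def)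
  have \<delta>_transfer: "((\<lambda>i. r i * \<delta> (y i) - c powr \<tau> * (r i * \<delta> (u i))) \<longlongrightarrow> 0) Fl"
    if y: "((\<lambda>i. y i / b i) \<longlongrightarrow> c) Fl" and "c > 0" for y c
  proof -
    have "((\<lambda>i. \<delta> (u i * (y i / u i)) / \<delta> (u i) - c powr \<tau>) \<longlongrightarrow> c powr \<tau> - c powr \<tau>) Fl"
      using quot[OF y ub] \<open>c > 0\<close> by (intro tendsto_diff tendsto_const \<delta>_ratio_tendsto u_top) auto
    then have "((\<lambda>i. (\<delta> (u i * (y i / u i)) / \<delta> (u i) - c powr \<tau>) * (r i * \<delta> (u i))) \<longlongrightarrow> 0) Fl"
      by (intro lim_null_mult_right_bounded[where B = K]) (use K in auto)
    moreover have "\<forall>\<^sub>F i in Fl. (\<delta> (u i * (y i / u i)) / \<delta> (u i) - c powr \<tau>) * (r i * \<delta> (u i))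
        = r i * \<delta> (y i) - c powr \<tau> * (r i * \<delta> (u i))"
      using u0 eventually_compose_filterlim[OF \<delta>_nonzero u_top]
      by eventually_elim (simp add: field_simps)
    ultimately show ?thesis by (rule Lim_transform_eventually)
  qed
  have v_diff: "((\<lambda>i. r i * \<delta> (v i) - r i * \<delta> (u i)) \<longlongrightarrow> 0) Fl"
    using \<delta>_transfer[OF vb] by simp
  have x_diff: "((\<lambda>i. r i * \<delta> (x i) - q' * (r i * \<delta> (u i))) \<longlongrightarrow> 0) Fl"
    using \<delta>_transfer[OF xb] Q1 by (simp add: q'_eq)
  have vx_diff: "((\<lambda>i. r i * \<delta> (x i) - q' * (r i * \<delta> (v i))) \<longlongrightarrow> 0) Fl"
    using tendsto_diff[OF x_diff tendsto_mult[OF tendsto_const[of q'] v_diff]]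
    by (simp add: algebra_simps)
  have rv: "\<forall>\<^sub>F i in Fl. \<bar>r i * \<delta> (v i)\<bar> \<le> K + 1"
    using K tendstoD[OF v_diff zero_less_one] by eventually_elim (auto simp: dist_real_def)
  have rx: "\<forall>\<^sub>F i in Fl. \<bar>r i * \<delta> (x i)\<bar> \<le> \<bar>q'\<bar> * K + 1"
    using K tendstoD[OF x_diff zero_less_one]
  proof eventually_elim
    case (elim i)
    have "\<bar>q' * (r i * \<delta> (u i))\<bar> \<le> \<bar>q'\<bar> * K"
      unfolding abs_mult[of q'] using elim by (intro mult_left_mono) auto
    then show ?case using elim(2) unfolding dist_real_def by linarith
  qed

  \<comment> \<open>The estimated parameters converge to \<open>\<gamma>\<close>, \<open>0\<close>, \<open>\<tau>\<close>, an interior point of the parameter range.\<close>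
  have g_null: "((\<lambda>i. g i / r i) \<longlongrightarrow> 0) Fl" and d_null: "((\<lambda>i. d i / r i) \<longlongrightarrow> 0) Fl"
    using lim_null_mult_left_bounded[OF _ r_inv, of g B] lim_null_mult_left_bounded[OF _ r_inv, of d B] g d
    by (auto simp: divide_inverse)
  have \<gamma>'_lim: "(\<gamma>' \<longlongrightarrow> \<gamma>) Fl"
    using tendsto_add[OF tendsto_const[of \<gamma>] g_null] by (simp add: \<gamma>'_def[abs_def])
  have \<gamma>'0: "\<forall>\<^sub>F i in Fl. \<gamma>' i > 0" by (rule order_tendstoD(1)[OF \<gamma>'_lim \<gamma>_pos])
  have \<delta>'_lim: "(\<delta>' \<longlongrightarrow> 0) Fl"
    using tendsto_add[OF filterlim_compose[OF \<delta>_null v_top] d_null] by (simp add: \<delta>'_def[abs_def])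
  have "((\<lambda>i. \<delta>' i - max (-1) (1 / th i)) \<longlongrightarrow> 0 - max (-1) (1 / \<tau>)) Fl"
    using \<tau>_neg by (intro tendsto_intros \<delta>'_lim th) auto
  moreover have "0 - max (-1) (1 / \<tau>) > 0" using \<tau>_neg by (auto simp: max_def divide_less_0_iff)
  ultimately have "\<forall>\<^sub>F i in Fl. \<delta>' i - max (-1) (1 / th i) > 0" by (intro order_tendstoD(1))
  with \<gamma>'0 order_tendstoD(2)[OF th \<tau>_neg] show ?params
    by eventually_elim (simp add: epd_params_def \<gamma>'_def \<delta>'_def)

  have Yth: "((\<lambda>i. 1 - Y i powr th i) \<longlongrightarrow> 1 - q') Fl"
    using Q1 by (subst q'_eq[symmetric], intro tendsto_intros Y_lim th) auto
  define D where "D i = r i * \<delta> (v i) + d i" for i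
  have D_bound: "\<forall>\<^sub>F i in Fl. \<bar>D i\<bar> \<le> K + 1 + B"
    using rv d by eventually_elim (auto simp: D_def)
  have rw4: "\<forall>\<^sub>F i in Fl. r i * w4 i = D i * (1 - Y i powr th i)"
    using r0 by eventually_elim (simp add: w4_def \<delta>'_def D_def field_simps)
  have w4_bound: "\<forall>\<^sub>F i in Fl. \<bar>r i * w4 i\<bar> \<le> (K + 1 + B) * (\<bar>1 - q'\<bar> + 1)"
    using rw4 D_bound tendstoD[OF Yth zero_less_one]
  proof eventually_elim
    case (elim i)
    then show ?case unfolding elim(1) abs_mult by (intro mult_mono) (auto simp: dist_real_def)
  qed

  \<comment> \<open>\<open>S\<close> will be \<open>r\<close> times the logarithm of the ratio, and \<open>Lin\<close> is its linearization.\<close>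
  have ln_deriv: "((\<lambda>z. ln (1 + z)) has_real_derivative 1) (at 0)"
    by (auto intro!: derivative_eq_intros)
  have ln_exp: "((\<lambda>i. r i * ln (1 + w i) - r i * w i) \<longlongrightarrow> 0) Fl"
    if "\<forall>\<^sub>F i in Fl. \<bar>r i * w i\<bar> \<le> B'" for w B'
    using scaled_increment[OF r that ln_deriv] by simp
  have w2_bound: "\<forall>\<^sub>F i in Fl. \<bar>r i * w2 i\<bar> \<le> (K + 1) / \<gamma>"
    using rv by eventually_elim (use \<gamma>_pos in \<open>simp add: w2_def field_simps abs_mult\<close>)
  have w3_bound: "\<forall>\<^sub>F i in Fl. \<bar>r i * w3 i\<bar> \<le> (\<bar>q'\<bar> * K + 1) / \<gamma>"
    using rx by eventually_elim (use \<gamma>_pos in \<open>simp add: w3_def field_simps abs_mult\<close>)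
  have w1_bound: "\<forall>\<^sub>F i in Fl. \<bar>r i * w1 i\<bar> \<le> B" using z by (simp add: w1_def)
  note ln1 = ln_exp[OF w1_bound] and ln2 = ln_exp[OF w2_bound]
    and ln3 = ln_exp[OF w3_bound] and ln4 = ln_exp[OF w4_bound]
  have near_1: "\<forall>\<^sub>F i in Fl. 1 + w i > 0" if "\<forall>\<^sub>F i in Fl. \<bar>r i * w i\<bar> \<le> B'" for w B'
    using order_tendstoD(1)[OF bounded_imp_null_over_at_top[OF r that], of "-1"]
    by (auto elim: eventually_mono)
  define S where "S i = - (r i * ln (1 + w1 i)) + g i * (ln (Y i) / (\<gamma> * \<gamma>' i)) + r i * ln (1 + w2 i)
      - r i * ln (1 + w3 i) - 1 / \<gamma>' i * (r i * ln (1 + w4 i))" for i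
  define Lin where "Lin i = - (1 / \<gamma>) * g i * ln q - (1 / \<gamma>) * d i * (1 - q') - r i * w1 i" for i
  have g_term: "((\<lambda>i. g i * (ln (Y i) / (\<gamma> * \<gamma>' i) + ln q / \<gamma>)) \<longlongrightarrow> 0) Fl"
  proof (rule lim_null_mult_left_bounded[where B = B])
    have "((\<lambda>i. ln (Y i) / (\<gamma> * \<gamma>' i) + ln q / \<gamma>) \<longlongrightarrow> ln Q / (\<gamma> * \<gamma>) + ln q / \<gamma>) Fl"
      using Q1 \<gamma>_pos by (intro tendsto_intros Y_lim \<gamma>'_lim) auto
    moreover have "ln Q / (\<gamma> * \<gamma>) + ln q / \<gamma> = 0" using \<gamma>_pos q by (simp add: Q_def ln_powr field_simps)
    ultimately show "((\<lambda>i. ln (Y i) / (\<gamma> * \<gamma>' i) + ln q / \<gamma>) \<longlongrightarrow> 0) Fl" by simp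
  qed (use g in auto)
  have D_term: "((\<lambda>i. D i * ((1 - Y i powr th i) / \<gamma>' i - (1 - q') / \<gamma>)) \<longlongrightarrow> 0) Fl"
  proof (rule lim_null_mult_left_bounded[where B = "K + 1 + B"])
    have "((\<lambda>i. (1 - Y i powr th i) / \<gamma>' i - (1 - q') / \<gamma>) \<longlongrightarrow> (1 - q') / \<gamma> - (1 - q') / \<gamma>) Fl"
      using \<gamma>_pos by (intro tendsto_diff tendsto_divide tendsto_const Yth \<gamma>'_lim) auto
    then show "((\<lambda>i. (1 - Y i powr th i) / \<gamma>' i - (1 - q') / \<gamma>) \<longlongrightarrow> 0) Fl" by simp
  qed (use D_bound in auto)
  \<comment> \<open>A sum of null terms: the linearization errors, the convergence of the coefficients of \<open>g\<close> and
      \<open>D\<close>, and the cancellation between \<open>\<delta> x\<close> and \<open>\<delta> v\<close>.\<close>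
  have "((\<lambda>i. - (r i * ln (1 + w1 i) - r i * w1 i) + g i * (ln (Y i) / (\<gamma> * \<gamma>' i) + ln q / \<gamma>)
      + (r i * ln (1 + w2 i) - r i * w2 i) - (r i * ln (1 + w3 i) - r i * w3 i)
      - 1 / \<gamma>' i * (r i * ln (1 + w4 i) - r i * w4 i)
      - D i * ((1 - Y i powr th i) / \<gamma>' i - (1 - q') / \<gamma>)
      - 1 / \<gamma> * (r i * \<delta> (x i) - q' * (r i * \<delta> (v i))))
      \<longlongrightarrow> - 0 + 0 + 0 - 0 - 1 / \<gamma> * 0 - 0 - 1 / \<gamma> * 0) Fl"
    using \<gamma>_pos
    by (intro tendsto_add tendsto_diff tendsto_minus tendsto_mult tendsto_divide tendsto_const
        ln1 ln2 ln3 ln4 g_term D_term vx_diff \<gamma>'_lim) auto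
  moreover have "\<forall>\<^sub>F i in Fl. - (r i * ln (1 + w1 i) - r i * w1 i) + g i * (ln (Y i) / (\<gamma> * \<gamma>' i) + ln q / \<gamma>)
      + (r i * ln (1 + w2 i) - r i * w2 i) - (r i * ln (1 + w3 i) - r i * w3 i)
      - 1 / \<gamma>' i * (r i * ln (1 + w4 i) - r i * w4 i)
      - D i * ((1 - Y i powr th i) / \<gamma>' i - (1 - q') / \<gamma>)
      - 1 / \<gamma> * (r i * \<delta> (x i) - q' * (r i * \<delta> (v i))) = S i - Lin i"
    using rw4 \<gamma>'0
  proof eventually_elim
    case (elim i)
    have w23: "r i * w2 i = r i * \<delta> (v i) * inverse \<gamma>" "r i * w3 i = r i * \<delta> (x i) * inverse \<gamma>"
      by (simp_all add: w2_def w3_def divide_inverse)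
    show ?case
      unfolding elim(1) w23 S_def Lin_def D_def by (simp add: divide_inverse algebra_simps)
  qed
  ultimately have S_Lin: "((\<lambda>i. S i - Lin i) \<longlongrightarrow> 0) Fl"
    by (auto elim: Lim_transform_eventually)
  define L where "L = \<bar>(1 / \<gamma>) * ln q\<bar> * B + \<bar>(1 / \<gamma>) * (1 - q')\<bar> * B + B"
  have S_bound: "\<forall>\<^sub>F i in Fl. \<bar>S i\<bar> \<le> L + 1"
    using tendstoD[OF S_Lin zero_less_one] g d w1_bound
  proof eventually_elim
    case (elim i)
    have "\<bar>((1 / \<gamma>) * ln q) * g i\<bar> \<le> \<bar>(1 / \<gamma>) * ln q\<bar> * B"
      using elim(2) unfolding abs_mult[of _ "g i"] by (intro mult_left_mono) auto
    moreover have "\<bar>((1 / \<gamma>) * (1 - q')) * d i\<bar> \<le> \<bar>(1 / \<gamma>) * (1 - q')\<bar> * B"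
      using elim(3) unfolding abs_mult[of _ "d i"] by (intro mult_left_mono) auto
    moreover have "Lin i = - (((1 / \<gamma>) * ln q) * g i) - ((1 / \<gamma>) * (1 - q')) * d i - r i * w1 i"
      by (simp add: Lin_def mult.commute)
    ultimately show ?case using elim(1,4) unfolding L_def dist_real_def by linarith
  qed

  \<comment> \<open>As \<open>S\<close> is bounded, \<open>r * (exp (S / r) - 1)\<close> differs from \<open>S\<close> by a null term.\<close>
  have rS: "\<forall>\<^sub>F i in Fl. r i * (S i / r i) = S i"
    using r0 by eventually_elim simp
  have S_bound': "\<forall>\<^sub>F i in Fl. \<bar>r i * (S i / r i)\<bar> \<le> L + 1"
    using rS S_bound by eventually_elim simp
  have "((\<lambda>i. r i * (exp (S i / r i) - exp 0) - 1 * (r i * (S i / r i)) + (S i - Lin i)) \<longlongrightarrow> 0 + 0) Fl"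
    using DERIV_exp[of "0::real"] by (intro tendsto_add S_Lin scaled_increment[OF r S_bound']) simp
  moreover have "\<forall>\<^sub>F i in Fl. r i * (exp (S i / r i) - exp 0) - 1 * (r i * (S i / r i)) + (S i - Lin i)
      = r i * (1 / m i * (1 - epd_cdf (\<gamma>' i) (\<delta>' i) (th i) (Y i)) / (1 - F (x i)) - 1) - Lin i"
    using m0 r0 v0 x0 Y1 \<gamma>'0 rS
      near_1[OF w2_bound] near_1[OF w3_bound] near_1[OF w4_bound]
  proof eventually_elim
    case (elim i)
    have pos: "1 + w1 i > 0" "1 + w2 i > 0" "1 + w3 i > 0" "1 + w4 i > 0" "1 - F (x i) > 0" "Y i > 0"
      using elim survival_pos[of "v i"] survival_pos[of "x i"] by (auto simp: w1_def)
    have lnv: "ln (1 + w1 i) = ln (m i) + ln C - ln (v i) / \<gamma> + ln (1 + w2 i)"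
    proof -
      have "1 + w1 i = m i * (C * v i powr (- 1 / \<gamma>) * (1 + w2 i))"
        using tail_delta_eq[OF tail \<gamma>_pos \<open>v i > 0\<close>] by (simp add: w1_def w2_def)
      then show ?thesis using elim pos C_pos by (simp add: ln_mult ln_powr)
    qed
    have lnx: "ln (1 - F (x i)) = ln C - ln (x i) / \<gamma> + ln (1 + w3 i)"
    proof -
      have "1 - F (x i) = C * x i powr (- 1 / \<gamma>) * (1 + w3 i)"
        using tail_delta_eq[OF tail \<gamma>_pos \<open>x i > 0\<close>] by (simp add: w3_def)
      then show ?thesis using elim pos C_pos by (simp add: ln_mult ln_powr)
    qed
    have epd: "1 - epd_cdf (\<gamma>' i) (\<delta>' i) (th i) (Y i) = (Y i * (1 + w4 i)) powr (- 1 / \<gamma>' i)"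
      using elim by (simp add: epd_cdf_def w4_def algebra_simps)
    have lnY: "ln (Y i) = ln (x i) - ln (v i)" using elim by (simp add: Y_def ln_div)
    have S_r: "S i / r i = - ln (1 + w1 i) + (g i / r i) * (ln (Y i) / (\<gamma> * \<gamma>' i)) + ln (1 + w2 i)
        - ln (1 + w3 i) - 1 / \<gamma>' i * ln (1 + w4 i)"
      using elim by (simp add: S_def add_divide_distrib diff_divide_distrib)
    have g_part: "(g i / r i) * (ln (Y i) / (\<gamma> * \<gamma>' i)) = (1 / \<gamma> - 1 / \<gamma>' i) * ln (Y i)"
      using elim \<gamma>_pos by (simp add: field_simps) (simp add: \<gamma>'_def field_simps)
    have lnxY: "ln (x i) = ln (Y i) + ln (v i)" using lnY by simp
    have "S i / r i = - ln (m i) + (- 1 / \<gamma>' i) * (ln (Y i) + ln (1 + w4 i)) - ln (1 - F (x i))"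
      unfolding S_r g_part lnv lnx lnxY by (simp add: divide_inverse algebra_simps)
    also have "\<dots> = ln (1 / m i * (Y i * (1 + w4 i)) powr (- 1 / \<gamma>' i) / (1 - F (x i)))"
      using elim pos by (simp add: ln_mult ln_div ln_powr)
    finally have "exp (S i / r i) = 1 / m i * (1 - epd_cdf (\<gamma>' i) (\<delta>' i) (th i) (Y i)) / (1 - F (x i))"
      using elim pos unfolding epd by simp
    then show ?case using elim by simp
  qed
  ultimately have "((\<lambda>i. r i * (1 / m i * (1 - epd_cdf (\<gamma>' i) (\<delta>' i) (th i) (Y i)) / (1 - F (x i)) - 1)
      - Lin i) \<longlongrightarrow> 0) Fl"
    by (auto elim: Lim_transform_eventually)
  then show ?expansion by (simp add: \<gamma>'_def \<delta>'_def Y_def Lin_def q'_def w1_def)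
qed

end

section \<open>Convergence in distribution\<close>

text \<open>
  Slutsky's theorem. Characteristic functions suit it because \<open>iexp\<close> is both bounded and
  Lipschitz: the characteristic functions of two variables that differ by at most \<open>\<epsilon>\<close> outside an event
  of small probability differ at \<open>t\<close> by at most \<open>\<bar>t\<bar> * \<epsilon>\<close> plus twice that probability.
\<close>

lemma (in prob_space) Slutsky_null:
  fixes Y Y' :: "nat \<Rightarrow> 'a \<Rightarrow> real" and L :: "real measure"
  assumes [measurable]: "\<And>n. Y n \<in> borel_measurable M" "\<And>n. Y' n \<in> borel_measurable M"
    and L: "real_distribution L"
    and conv: "weak_conv_m (\<lambda>n. distr M borel (Y n)) L"
    and diff: "conv_in_prob M (\<lambda>n \<omega>. Y' n \<omega> - Y n \<omega>) 0"
  shows "weak_conv_m (\<lambda>n. distr M borel (Y' n)) L"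
proof (rule levy_continuity)
  show "real_distribution (distr M borel (Y' n))" for n
    by (intro real_distribution_distr) simp
  show "real_distribution L" by fact
  fix t
  have char_eq: "char (distr M borel W) t = (CLINT \<omega>|M. iexp (t * W \<omega>))"
    if [measurable]: "W \<in> borel_measurable M" for W
    by (simp add: char_def integral_distr)
  have int: "integrable M (\<lambda>\<omega>. iexp (t * W \<omega>))" if [measurable]: "W \<in> borel_measurable M" for W
    by (intro integrable_const_bound[where B = 1]) auto
  have gap: "cmod (char (distr M borel (Y' n)) t - char (distr M borel (Y n)) t)
      \<le> \<bar>t\<bar> * \<epsilon> + 2 * prob {\<omega> \<in> space M. \<bar>Y' n \<omega> - Y n \<omega> - 0\<bar> > \<epsilon>}" if "\<epsilon> > 0" for n \<epsilon>
  proof -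
    let ?E = "{\<omega> \<in> space M. \<bar>Y' n \<omega> - Y n \<omega> - 0\<bar> > \<epsilon>}"
    have "cmod (char (distr M borel (Y' n)) t - char (distr M borel (Y n)) t)
        = cmod (CLINT \<omega>|M. iexp (t * Y' n \<omega>) - iexp (t * Y n \<omega>))"
      using int[of "Y n"] int[of "Y' n"] by (simp add: char_eq)
    also have "\<dots> \<le> (\<integral>\<omega>. \<bar>t\<bar> * \<epsilon> + 2 * indicator ?E \<omega> \<partial>M)"
    proof (rule order_trans[OF integral_norm_bound integral_mono])
      show "integrable M (\<lambda>\<omega>. cmod (iexp (t * Y' n \<omega>) - iexp (t * Y n \<omega>)))"
        using int[of "Y n"] int[of "Y' n"] by auto
      show "integrable M (\<lambda>\<omega>. \<bar>t\<bar> * \<epsilon> + 2 * indicator ?E \<omega>)"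
        by (intro Bochner_Integration.integrable_add integrable_const integrable_mult_right
            integrable_real_indicator) (auto simp: emeasure_eq_measure)
      fix \<omega> assume "\<omega> \<in> space M"
      have "iexp (t * Y' n \<omega>) - iexp (t * Y n \<omega>)
          = iexp (t * Y n \<omega>) * (iexp (t * (Y' n \<omega> - Y n \<omega>)) - 1)"
        by (simp add: algebra_simps flip: exp_add)
      then have eq: "cmod (iexp (t * Y' n \<omega>) - iexp (t * Y n \<omega>))
          = cmod (iexp (t * (Y' n \<omega> - Y n \<omega>)) - 1)"
        by (simp add: norm_mult)
      show "cmod (iexp (t * Y' n \<omega>) - iexp (t * Y n \<omega>)) \<le> \<bar>t\<bar> * \<epsilon> + 2 * indicator ?E \<omega>"
      proof (cases "\<omega> \<in> ?E")
        case True
        have "cmod (iexp (t * Y' n \<omega>) - iexp (t * Y n \<omega>)) \<le> 2"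
          using norm_triangle_ineq4[of "iexp (t * Y' n \<omega>)" "iexp (t * Y n \<omega>)"]
          by (simp del: of_real_mult)
        moreover have "0 \<le> \<bar>t\<bar> * \<epsilon>" using \<open>\<epsilon> > 0\<close> by simp
        ultimately show ?thesis using True by simp
      next
        case False
        have "cmod (iexp (t * (Y' n \<omega> - Y n \<omega>)) - 1) \<le> \<bar>t * (Y' n \<omega> - Y n \<omega>)\<bar>"
          using iexp_approx1[of "t * (Y' n \<omega> - Y n \<omega>)" 0] by (simp del: of_real_mult)
        also have "\<dots> \<le> \<bar>t\<bar> * \<epsilon>"
          using False \<open>\<omega> \<in> space M\<close> by (simp add: abs_mult mult_left_mono)
        finally show ?thesis using False unfolding eq by simp
      qed
    qed
    also have "\<dots> = \<bar>t\<bar> * \<epsilon> + 2 * prob ?E"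
      by (subst Bochner_Integration.integral_add)
        (auto simp: prob_space emeasure_eq_measure intro!: integrable_real_indicator)
    finally show ?thesis .
  qed
  have "(\<lambda>n. char (distr M borel (Y' n)) t - char (distr M borel (Y n)) t) \<longlonglongrightarrow> 0"
  proof (rule tendstoI)
    fix e :: real assume "e > 0"
    define \<epsilon> where "\<epsilon> = e / (2 * (\<bar>t\<bar> + 1))"
    have \<epsilon>: "\<epsilon> > 0" using \<open>e > 0\<close> by (simp add: \<epsilon>_def)
    have "\<bar>t\<bar> * \<epsilon> \<le> (\<bar>t\<bar> + 1) * \<epsilon>" using \<epsilon> by simp
    also have "\<dots> = e / 2" by (simp add: \<epsilon>_def field_simps)
    finally have small: "\<bar>t\<bar> * \<epsilon> \<le> e / 2" .
    have "(\<lambda>n. prob {\<omega> \<in> space M. \<bar>Y' n \<omega> - Y n \<omega> - 0\<bar> > \<epsilon>}) \<longlonglongrightarrow> 0"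
      using diff \<epsilon> unfolding conv_in_prob_def by blast
    from order_tendstoD(2)[OF this, of "e / 4"] \<open>e > 0\<close>
    have "\<forall>\<^sub>F n in sequentially. prob {\<omega> \<in> space M. \<bar>Y' n \<omega> - Y n \<omega> - 0\<bar> > \<epsilon>} < e / 4" by simp
    then show "\<forall>\<^sub>F n in sequentially.
        dist (char (distr M borel (Y' n)) t - char (distr M borel (Y n)) t) 0 < e"
    proof eventually_elim
      case (elim n)
      then show ?case using gap[OF \<epsilon>, of n] small unfolding dist_0_norm dist_norm diff_0_right by linarith
    qed
  qed
  moreover have "(\<lambda>n. char (distr M borel (Y n)) t) \<longlonglongrightarrow> char L t"
    by (intro levy_continuity1 L conv real_distribution_distr) simp
  ultimately show "(\<lambda>n. char (distr M borel (Y' n)) t) \<longlonglongrightarrow> char L t"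
    using tendsto_add by fastforce
qed

text \<open>
  The truncated distance to a ball is a continuous bounded test function that dominates the
  indicator of the complement of a slightly larger ball, and its expectation under the limit law
  vanishes as the ball grows.
\<close>

lemma (in prob_space) conv_in_distr_imp_tight:
  fixes Y :: "nat \<Rightarrow> 'a \<Rightarrow> 'c::{real_normed_vector, second_countable_topology}" and Z :: "'b \<Rightarrow> 'c"
  assumes [measurable]: "\<And>n. Y n \<in> borel_measurable M"
    and N: "prob_space N" and [measurable]: "Z \<in> borel_measurable N"
    and conv: "conv_in_distr M Y N Z" and "\<eta> > 0"
  shows "\<exists>B. \<forall>\<^sub>F n in sequentially. prob {\<omega> \<in> space M. norm (Y n \<omega>) > B} < \<eta>"
proof -
  interpret N: prob_space N by fact
  define \<phi> where "\<phi> B y = min 1 (max 0 (norm y - B))" for B :: real and y :: 'c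
  have \<phi>_cont: "continuous_on UNIV (\<phi> B)" for B
    unfolding \<phi>_def by (intro continuous_intros)
  have [measurable]: "\<phi> B \<in> borel_measurable borel" for B
    by (rule borel_measurable_continuous_onI[OF \<phi>_cont])
  have \<phi>_nonneg: "0 \<le> \<phi> B y" and \<phi>_le: "\<phi> B y \<le> 1" for B y
    by (auto simp: \<phi>_def)
  have "(\<lambda>j. \<integral>\<omega>. \<phi> (real j) (Z \<omega>) \<partial>N) \<longlonglongrightarrow> (\<integral>\<omega>. 0 \<partial>N)"
  proof (rule integral_dominated_convergence[where w = "\<lambda>_. 1"])
    show "AE \<omega> in N. (\<lambda>j. \<phi> (real j) (Z \<omega>)) \<longlonglongrightarrow> 0"
    proof (intro AE_I2 tendsto_eventually)
      fix \<omega>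
      show "\<forall>\<^sub>F j in sequentially. \<phi> (real j) (Z \<omega>) = 0"
        using eventually_ge_at_top[of "nat \<lceil>norm (Z \<omega>)\<rceil>"]
      proof eventually_elim
        case (elim j)
        then have "norm (Z \<omega>) \<le> real j" by linarith
        then show ?case by (simp add: \<phi>_def)
      qed
    qed
  qed (use \<phi>_nonneg \<phi>_le in auto)
  from order_tendstoD(2)[OF this, of \<eta>] \<open>\<eta> > 0\<close>
  obtain j where j: "(\<integral>\<omega>. \<phi> (real j) (Z \<omega>) \<partial>N) < \<eta>"
    by (auto simp: eventually_sequentially)
  have "\<bar>\<phi> (real j) y\<bar> \<le> 1" for y
    using \<phi>_nonneg[of "real j" y] \<phi>_le[of "real j" y] by simp
  then have "bounded (range (\<phi> (real j)))"
    by (auto simp: bounded_iff)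
  then have "(\<lambda>n. \<integral>\<omega>. \<phi> (real j) (Y n \<omega>) \<partial>M) \<longlonglongrightarrow> (\<integral>\<omega>. \<phi> (real j) (Z \<omega>) \<partial>N)"
    using conv \<phi>_cont unfolding conv_in_distr_def by blast
  from order_tendstoD(2)[OF this j]
  have "\<forall>\<^sub>F n in sequentially. prob {\<omega> \<in> space M. norm (Y n \<omega>) > real j + 1} < \<eta>"
  proof eventually_elim
    case (elim n)
    let ?E = "{\<omega> \<in> space M. norm (Y n \<omega>) > real j + 1}"
    have "prob ?E = (\<integral>\<omega>. indicator ?E \<omega> \<partial>M)" by simp
    also have "\<dots> \<le> (\<integral>\<omega>. \<phi> (real j) (Y n \<omega>) \<partial>M)"
    proof (rule integral_mono)
      show "integrable M (\<lambda>\<omega>. \<phi> (real j) (Y n \<omega>))"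
        by (rule integrable_const_bound[where B = 1]) (use \<phi>_nonneg \<phi>_le in auto)
    next
      fix \<omega>
      show "indicator ?E \<omega> \<le> \<phi> (real j) (Y n \<omega>)"
        by (auto simp: \<phi>_def split: split_indicator)
    qed (auto simp: emeasure_eq_measure intro!: integrable_real_indicator)
    finally show ?case using elim by simp
  qed
  then show ?thesis by blast
qed

section \<open>Order statistics are random variables\<close>

text \<open>
  Counting the observations up to \<open>t\<close> is visibly a measurable operation on the sample; sorting it is not.
\<close>

lemma nth_sort_le_iff:
  fixes xs :: "'b :: linorder list"
  assumes "m < length xs"
  shows "sort xs ! m \<le> t \<longleftrightarrow> m < length (filter (\<lambda>x. x \<le> t) xs)"
proof -
  define S where "S = {i. i < length (sort xs) \<and> sort xs ! i \<le> t}"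
  have "length (filter (\<lambda>x. x \<le> t) xs) = length (filter (\<lambda>x. x \<le> t) (sort xs))"
    by (metis mset_filter mset_sort size_mset)
  also have "\<dots> = card S" unfolding S_def by (rule length_filter_conv_card)
  finally have card: "length (filter (\<lambda>x. x \<le> t) xs) = card S" .
  have fin: "finite S" by (simp add: S_def)
  show ?thesis
  proof
    assume le: "sort xs ! m \<le> t"
    have "{..m} \<subseteq> S"
    proof
      fix i assume "i \<in> {..m}"
      then have "sort xs ! i \<le> sort xs ! m" using assms by (intro sorted_nth_mono) auto
      then show "i \<in> S" using le assms \<open>i \<in> {..m}\<close> by (auto simp: S_def)
    qed
    then have "card {..m} \<le> card S" by (intro card_mono fin)
    then show "m < length (filter (\<lambda>x. x \<le> t) xs)" by (simp add: card)
  next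
    assume "m < length (filter (\<lambda>x. x \<le> t) xs)"
    then have "\<not> S \<subseteq> {..<m}" using card card_mono[of "{..<m}" S] by auto
    then obtain i where "i \<in> S" "m \<le> i" by (meson lessThan_iff not_less subsetI)
    then show "sort xs ! m \<le> t"
      using sorted_nth_mono[of "sort xs" m i] by (auto simp: S_def)
  qed
qed

lemma borel_measurable_order_stat:
  assumes X: "\<And>i. 1 \<le> i \<Longrightarrow> X i \<in> borel_measurable M" and "j \<le> n"
  shows "order_stat X j n \<in> borel_measurable M"
proof (cases "n = 0")
  case True
  then have "order_stat X j n = (\<lambda>\<omega>. sort [] ! (j - 1))" by (simp add: order_stat_def fun_eq_iff)
  then show ?thesis by simp
next
  case False
  then have m: "j - 1 < n" using \<open>j \<le> n\<close> by auto
  have [measurable]: "X i \<in> borel_measurable M" if "i \<in> {1..<Suc n}" for i using that X by auto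
  have count: "real (length (filter (\<lambda>x. x \<le> t) (map (\<lambda>i. X i \<omega>) [1..<Suc n])))
      = (\<Sum>i\<in>{1..<Suc n}. indicator {..t} (X i \<omega>))" for t \<omega>
  proof -
    have *: "real (length (filter (\<lambda>x. x \<le> t) (map (\<lambda>i. X i \<omega>) is)))
        = sum_list (map (\<lambda>i. indicator {..t} (X i \<omega>)) is)" for "is"
      by (induction "is") auto
    show ?thesis by (simp only: * sum_set_upt_conv_sum_list_nat[symmetric] set_upt)
  qed
  show ?thesis
  proof (rule borel_measurableI_le)
    fix t
    have "{\<omega> \<in> space M. order_stat X j n \<omega> \<le> t}
        = {\<omega> \<in> space M. real (j - 1) < (\<Sum>i\<in>{1..<Suc n}. indicator {..t} (X i \<omega>))}"
      using m unfolding order_stat_def count[symmetric] by (subst nth_sort_le_iff) auto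
    also have "\<dots> \<in> sets M" by measurable
    finally show "{\<omega> \<in> space M. order_stat X j n \<omega> \<le> t} \<in> sets M" .
  qed
qed

section \<open>The limit law of the tail probability estimator\<close>

theorem theorem5p1:
  fixes M :: "'a measure" and N :: "'b measure"
    and X :: "nat \<Rightarrow> 'a \<Rightarrow> real" and F :: "real \<Rightarrow> real"
    and \<gamma> \<tau> \<rho> lam q :: real
    and k :: "nat \<Rightarrow> nat" and x p :: "nat \<Rightarrow> real"
    and \<gamma>hat \<delta>hat \<tau>hat phat :: "nat \<Rightarrow> 'a \<Rightarrow> real"
    and G D Z :: "'b \<Rightarrow> real"
  assumes "\<gamma> > 0" and "\<tau> < 0" and "\<rho> = \<gamma> * \<tau>"
    and "prob_space M"
    and "prob_space.indep_vars M (\<lambda>_. borel) X {1..}"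
    and "\<And>i. i \<ge> 1 \<Longrightarrow> cdf (distr M borel (X i)) = F"
    and "tail_class \<gamma> \<tau> F" and "F 0 = 0"
    and "\<And>n. n \<ge> 2 \<Longrightarrow> k n \<in> {1..n - 1}"
    and "filterlim k at_top sequentially"
    and "(\<lambda>n. real (k n) / real n) \<longlonglongrightarrow> 0"
    and "(\<lambda>n. sqrt (real (k n)) * tail_a \<gamma> F (real n / real (k n))) \<longlonglongrightarrow> lam"
    and "filterlim x at_top sequentially"
    and "\<And>n. p n = 1 - F (x n)"
    and "(\<lambda>n. real n * p n / real (k n)) \<longlonglongrightarrow> q" and "0 < q" and "q < 1"
    and "\<And>n. \<gamma>hat n \<in> borel_measurable M"
    and "\<And>n. \<delta>hat n \<in> borel_measurable M"
    and "\<And>n. \<tau>hat n \<in> borel_measurable M"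
    and "conv_in_prob M \<tau>hat \<tau>"
    and "prob_space N"
    and "G \<in> borel_measurable N" and "D \<in> borel_measurable N" and "Z \<in> borel_measurable N"
    and "conv_in_distr M
           (\<lambda>n \<omega>. (sqrt (real (k n)) * (\<gamma>hat n \<omega> - \<gamma>),
                    sqrt (real (k n)) *
                      (\<delta>hat n \<omega> - tail_delta \<gamma> F (order_stat X (n - k n) n \<omega>)),
                    sqrt (real (k n)) *
                      (real n * (1 - F (order_stat X (n - k n) n \<omega>)) / real (k n) - 1)))
           N (\<lambda>\<omega>. (G \<omega>, D \<omega>, Z \<omega>))"
    \<comment> \<open>outside the EPD parameter range the estimator may take arbitrary values\<close>
    and "\<And>n. phat n \<in> borel_measurable M"
    and "\<And>n \<omega>. \<omega> \<in> space M \<Longrightarrow> epd_params (\<gamma>hat n \<omega>) (\<delta>hat n \<omega>) (\<tau>hat n \<omega>) \<Longrightarrow>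
           phat n \<omega> = real (k n) / real n *
             (1 - epd_cdf (\<gamma>hat n \<omega>) (\<delta>hat n \<omega>) (\<tau>hat n \<omega>) (x n / order_stat X (n - k n) n \<omega>))"
  shows "weak_conv_m
           (\<lambda>n. distr M borel (\<lambda>\<omega>. sqrt (real (k n)) * (phat n \<omega> / p n - 1)))
           (distr N borel
             (\<lambda>\<omega>. - (1 / \<gamma>) * G \<omega> * ln q - (1 / \<gamma>) * D \<omega> * (1 - q powr (- \<rho>)) - Z \<omega>))"
proof -
  interpret prob_space M by fact
  define V where "V n \<omega> = order_stat X (n - k n) n \<omega>" for n \<omega>
  define r where "r n = sqrt (real (k n))" for n
  define m where "m n = real n / real (k n)" for n
  define \<Gamma> where "\<Gamma> n \<omega> = r n * (\<gamma>hat n \<omega> - \<gamma>)" for n \<omega>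
  define \<Delta> where "\<Delta> n \<omega> = r n * (\<delta>hat n \<omega> - tail_delta \<gamma> F (V n \<omega>))" for n \<omega>
  define \<zeta> where "\<zeta> n \<omega> = r n * (m n * (1 - F (V n \<omega>)) - 1)" for n \<omega>
  define T where "T n \<omega> = (\<Gamma> n \<omega>, \<Delta> n \<omega>, \<zeta> n \<omega>)" for n \<omega>
  define \<Lambda> where "\<Lambda> y = - (1 / \<gamma>) * fst y * ln q - (1 / \<gamma>) * fst (snd y) * (1 - q powr (- \<rho>)) - snd (snd y)"
    for y :: "real \<times> real \<times> real"
  define W where "W n \<omega> = r n * (phat n \<omega> / p n - 1)" for n \<omega>

  have X_meas: "X i \<in> borel_measurable M" if "1 \<le> i" for i
    using assms(5) that unfolding indep_vars_def by auto
  have mono_F: "mono F"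
  proof -
    interpret D: real_distribution "distr M borel (X 1)" by (intro real_distribution_distr X_meas) simp
    have "F = cdf (distr M borel (X 1))" using assms(6)[of 1] by simp
    then show ?thesis by (metis monoI D.cdf_nondecreasing)
  qed
  interpret heavy_tail \<gamma> \<tau> F by (rule heavy_tail.intro; fact)

  have V_meas [measurable]: "V n \<in> borel_measurable M" for n
    unfolding V_def[abs_def] by (intro borel_measurable_order_stat X_meas) auto
  have F_meas [measurable]: "F \<in> borel_measurable borel" by (rule borel_measurable_mono[OF mono])
  have [measurable]: "\<delta> \<in> borel_measurable borel" unfolding tail_delta_def[abs_def] by measurable
  note [measurable] = assms(18-20) assms(23-25) assms(27)
  have T_meas [measurable]: "T n \<in> borel_measurable M" for n
    unfolding T_def[abs_def] \<Gamma>_def \<Delta>_def \<zeta>_def by measurable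
  have \<Lambda>_cont: "continuous_on UNIV \<Lambda>"
    unfolding \<Lambda>_def by (intro continuous_intros)
  have [measurable]: "\<Lambda> \<in> borel_measurable borel"
    by (rule borel_measurable_continuous_onI[OF \<Lambda>_cont])
  have GDZ_meas [measurable]: "(\<lambda>\<omega>. (G \<omega>, D \<omega>, Z \<omega>)) \<in> borel_measurable N" by measurable
  have W_meas [measurable]: "W n \<in> borel_measurable M" for n
    unfolding W_def[abs_def] by measurable

  have T_conv: "conv_in_distr M T N (\<lambda>\<omega>. (G \<omega>, D \<omega>, Z \<omega>))"
    using assms(26) unfolding T_def[abs_def] \<Gamma>_def \<Delta>_def \<zeta>_def r_def m_def V_def by simp
  \<comment> \<open>Composing a test function with the continuous map \<open>\<Lambda>\<close> gives a test function.\<close>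
  have lin_conv: "weak_conv_m (\<lambda>n. distr M borel (\<lambda>\<omega>. \<Lambda> (T n \<omega>))) (distr N borel (\<lambda>\<omega>. \<Lambda> (G \<omega>, D \<omega>, Z \<omega>)))"
  proof (subst conv_in_distr_real_iff[symmetric])
    show "conv_in_distr M (\<lambda>n \<omega>. \<Lambda> (T n \<omega>)) N (\<lambda>\<omega>. \<Lambda> (G \<omega>, D \<omega>, Z \<omega>))"
      unfolding conv_in_distr_def
    proof (intro allI impI)
      fix f :: "real \<Rightarrow> real" assume f: "continuous_on UNIV f" "bounded (range f)"
      have "continuous_on UNIV (f \<circ> \<Lambda>)"
        by (intro continuous_on_compose \<Lambda>_cont continuous_on_subset[OF f(1)]) auto
      moreover have "bounded (range (f \<circ> \<Lambda>))" by (rule bounded_subset[OF f(2)]) auto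
      ultimately show "(\<lambda>n. \<integral>\<omega>. f (\<Lambda> (T n \<omega>)) \<partial>M) \<longlonglongrightarrow> (\<integral>\<omega>. f (\<Lambda> (G \<omega>, D \<omega>, Z \<omega>)) \<partial>N)"
        using T_conv[unfolded conv_in_distr_def, rule_format, of "f \<circ> \<Lambda>"] by simp
    qed
  qed (use assms(4,22) in measurable)

  have k_pos: "\<forall>\<^sub>F n in sequentially. k n > 0"
    by (rule eventually_compose_filterlim[OF eventually_gt_at_top assms(10)])
  have r_top: "filterlim r at_top sequentially"
    unfolding r_def by (intro filterlim_compose[OF sqrt_at_top] filterlim_compose[OF filterlim_real_sequentially] assms)
  have m_top: "filterlim m at_top sequentially"
  proof -
    have "\<forall>\<^sub>F n in sequentially. real (k n) / real n > 0"
      using k_pos eventually_gt_at_top[of 0] by eventually_elim simp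
    then have "filterlim (\<lambda>n. inverse (real (k n) / real n)) at_top sequentially"
      by (intro filterlim_inverse_at_top assms(11))
    then show ?thesis by (simp add: m_def[abs_def])
  qed
  have x_level: "(\<lambda>n. m n * (1 - F (x n))) \<longlonglongrightarrow> q"
    using assms(15) unfolding assms(14) m_def by simp
  obtain A where A: "\<And>n. \<bar>r n * tail_a \<gamma> F (m n)\<bar> \<le> A"
    using convergent_imp_bounded[OF assms(12)] by (auto simp: bounded_iff r_def m_def)

  \<comment> \<open>On the event that \<open>T\<close> is bounded by \<open>B\<close> and \<open>\<tau>hat\<close> is close to \<open>\<tau>\<close>, the linearization holds uniformly
      in the sample point. The filter on pairs of an index and a sample point expresses this regime:
      the index grows, \<open>\<tau>hat\<close> tends to \<open>\<tau>\<close>, and \<open>T\<close> stays bounded.\<close>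
  have key: "\<exists>\<eta>>0. \<forall>\<^sub>F n in sequentially. \<forall>\<omega>\<in>space M.
      \<bar>\<tau>hat n \<omega> - \<tau>\<bar> \<le> \<eta> \<longrightarrow> norm (T n \<omega>) \<le> B \<longrightarrow> \<bar>W n \<omega> - \<Lambda> (T n \<omega>)\<bar> \<le> \<epsilon>" if "\<epsilon> > 0" for B \<epsilon>
  proof -
    define \<A> where "\<A> = {(n, \<omega>). \<omega> \<in> space M \<and> norm (T n \<omega>) \<le> B}"
    define Fl where "Fl = inf (inf (filtercomap fst sequentially)
        (filtercomap (\<lambda>i. \<tau>hat (fst i) (snd i)) (nhds \<tau>))) (principal \<A>)"
    have Fl_fst: "filterlim fst sequentially Fl"
      unfolding filterlim_iff_le_filtercomap Fl_def by (intro le_infI1 inf_le1)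
    have pull: "filterlim (\<lambda>i. f (fst i)) Fl' Fl" if "filterlim f Fl' sequentially" for f :: "nat \<Rightarrow> real" and Fl'
      by (rule filterlim_compose[OF that Fl_fst])
    have in_\<A>: "\<forall>\<^sub>F i in Fl. i \<in> \<A>"
      unfolding Fl_def by (rule filter_leD[OF inf_le2]) (simp add: eventually_principal)
    have th: "((\<lambda>i. \<tau>hat (fst i) (snd i)) \<longlongrightarrow> \<tau>) Fl"
      unfolding filterlim_iff_le_filtercomap Fl_def by (intro le_infI1 inf_le2)
    have comp: "\<bar>y1\<bar> \<le> norm (y1, y2, y3) \<and> \<bar>y2\<bar> \<le> norm (y1, y2, y3) \<and> \<bar>y3\<bar> \<le> norm (y1, y2, y3)"
      for y1 y2 y3 :: real
      using norm_fst_le[of y1 "(y2, y3)"] norm_snd_le[of "(y2, y3)" y1]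
        norm_fst_le[of y2 y3] norm_snd_le[of y3 y2] by auto
    have bnd: "\<forall>\<^sub>F i in Fl. \<bar>\<Gamma> (fst i) (snd i)\<bar> \<le> B" "\<forall>\<^sub>F i in Fl. \<bar>\<Delta> (fst i) (snd i)\<bar> \<le> B"
      "\<forall>\<^sub>F i in Fl. \<bar>\<zeta> (fst i) (snd i)\<bar> \<le> B"
      using in_\<A> by (auto simp: \<A>_def T_def elim!: eventually_mono dest: order_trans[OF conjunct1[OF comp]]
          order_trans[OF conjunct1[OF conjunct2[OF comp]]] order_trans[OF conjunct2[OF conjunct2[OF comp]]])
    have r0: "\<forall>\<^sub>F i in Fl. r (fst i) > 0"
      using eventually_compose_filterlim[OF eventually_gt_at_top[of 0] pull[OF r_top]] .
    have A': "\<forall>\<^sub>F i in Fl. \<bar>r (fst i) * tail_a \<gamma> F (m (fst i))\<bar> \<le> A" using A by simp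
    note expand = epd_tail_expansion[where Fl = Fl and m = "\<lambda>i. m (fst i)" and r = "\<lambda>i. r (fst i)"
        and x = "\<lambda>i. x (fst i)" and v = "\<lambda>i. V (fst i) (snd i)" and g = "\<lambda>i. \<Gamma> (fst i) (snd i)"
        and d = "\<lambda>i. \<Delta> (fst i) (snd i)" and th = "\<lambda>i. \<tau>hat (fst i) (snd i)" and A = A and B = B and q = q,
        OF pull[OF m_top] pull[OF r_top] A' pull[OF x_level] assms(16,17) bnd(3)[unfolded \<zeta>_def] bnd(1,2) th]
    have "\<forall>\<^sub>F i in Fl. \<bar>W (fst i) (snd i) - \<Lambda> (T (fst i) (snd i))\<bar> < \<epsilon>"
      using expand(1) tendstoD[OF expand(2) \<open>\<epsilon> > 0\<close>] in_\<A> r0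
    proof eventually_elim
      case (elim i)
      obtain n \<omega> where i: "i = (n, \<omega>)" by (cases i)
      have par: "\<gamma> + \<Gamma> n \<omega> / r n = \<gamma>hat n \<omega>" "\<delta> (V n \<omega>) + \<Delta> n \<omega> / r n = \<delta>hat n \<omega>"
        using elim by (simp_all add: i \<Gamma>_def \<Delta>_def)
      have "phat n \<omega> = 1 / m n * (1 - epd_cdf (\<gamma>hat n \<omega>) (\<delta>hat n \<omega>) (\<tau>hat n \<omega>) (x n / V n \<omega>))"
      proof -
        have "epd_params (\<gamma>hat n \<omega>) (\<delta>hat n \<omega>) (\<tau>hat n \<omega>)" "\<omega> \<in> space M"
          using elim by (simp_all add: i par \<A>_def)
        from assms(28)[OF this(2,1)] show ?thesis by (simp add: V_def m_def)
      qed
      then show ?case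
        using elim by (simp add: i par W_def assms(3,14) \<Lambda>_def T_def \<zeta>_def dist_real_def)
    qed
    then obtain P1 P2 where P1: "eventually P1 sequentially" and P2: "eventually P2 (nhds \<tau>)"
      and P: "\<And>n \<omega>. P1 n \<Longrightarrow> P2 (\<tau>hat n \<omega>) \<Longrightarrow> (n, \<omega>) \<in> \<A> \<Longrightarrow> \<bar>W n \<omega> - \<Lambda> (T n \<omega>)\<bar> < \<epsilon>"
      unfolding Fl_def eventually_inf_principal by (fastforce simp: eventually_inf eventually_filtercomap)
    obtain \<eta> where \<eta>: "\<eta> > 0" "\<And>t. dist t \<tau> < \<eta> \<Longrightarrow> P2 t"
      using P2 by (auto simp: eventually_nhds_metric)
    show ?thesis
    proof (intro exI[of _ "\<eta> / 2"] conjI)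
      show "\<forall>\<^sub>F n in sequentially. \<forall>\<omega>\<in>space M.
          \<bar>\<tau>hat n \<omega> - \<tau>\<bar> \<le> \<eta> / 2 \<longrightarrow> norm (T n \<omega>) \<le> B \<longrightarrow> \<bar>W n \<omega> - \<Lambda> (T n \<omega>)\<bar> \<le> \<epsilon>"
        using P1
      proof eventually_elim
        case (elim n)
        then show ?case using \<eta> by (auto simp: dist_real_def \<A>_def intro!: less_imp_le[OF P])
      qed
    qed (use \<eta> in auto)
  qed

  have "conv_in_prob M (\<lambda>n \<omega>. W n \<omega> - \<Lambda> (T n \<omega>)) 0"
    unfolding conv_in_prob_def
  proof (intro allI impI tendstoI)
    fix \<epsilon> e :: real assume "\<epsilon> > 0" "e > 0"
    obtain B where B: "\<forall>\<^sub>F n in sequentially. prob {\<omega> \<in> space M. norm (T n \<omega>) > B} < e / 2"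
      using conv_in_distr_imp_tight[OF T_meas assms(22) GDZ_meas T_conv, of "e / 2"] \<open>e > 0\<close> by auto
    obtain \<eta> where "\<eta> > 0" and \<eta>: "\<forall>\<^sub>F n in sequentially. \<forall>\<omega>\<in>space M.
      \<bar>\<tau>hat n \<omega> - \<tau>\<bar> \<le> \<eta> \<longrightarrow> norm (T n \<omega>) \<le> B \<longrightarrow> \<bar>W n \<omega> - \<Lambda> (T n \<omega>)\<bar> \<le> \<epsilon>"
      using key[OF \<open>\<epsilon> > 0\<close>] by blast
    have "(\<lambda>n. prob {\<omega> \<in> space M. \<bar>\<tau>hat n \<omega> - \<tau>\<bar> > \<eta>}) \<longlonglongrightarrow> 0"
      using assms(21) \<open>\<eta> > 0\<close> unfolding conv_in_prob_def by blast
    then have "\<forall>\<^sub>F n in sequentially. prob {\<omega> \<in> space M. \<bar>\<tau>hat n \<omega> - \<tau>\<bar> > \<eta>} < e / 2"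
      using \<open>e > 0\<close> by (intro order_tendstoD(2)) auto
    with B \<eta> show "\<forall>\<^sub>F n in sequentially.
        dist (prob {\<omega> \<in> space M. \<bar>W n \<omega> - \<Lambda> (T n \<omega>) - 0\<bar> > \<epsilon>}) 0 < e"
    proof eventually_elim
      case (elim n)
      have "prob {\<omega> \<in> space M. \<bar>W n \<omega> - \<Lambda> (T n \<omega>) - 0\<bar> > \<epsilon>}
          \<le> prob ({\<omega> \<in> space M. norm (T n \<omega>) > B} \<union> {\<omega> \<in> space M. \<bar>\<tau>hat n \<omega> - \<tau>\<bar> > \<eta>})"
        using elim(2) by (intro finite_measure_mono) force+
      also have "\<dots> \<le> prob {\<omega> \<in> space M. norm (T n \<omega>) > B} + prob {\<omega> \<in> space M. \<bar>\<tau>hat n \<omega> - \<tau>\<bar> > \<eta>}"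
        by (rule measure_Un_le) measurable
      finally show ?case using elim(1,3) by (simp add: dist_real_def)
    qed
  qed
  then have "weak_conv_m (\<lambda>n. distr M borel (W n)) (distr N borel (\<lambda>\<omega>. \<Lambda> (G \<omega>, D \<omega>, Z \<omega>)))"
    by (intro Slutsky_null[OF _ _ _ lin_conv] prob_space.real_distribution_distr assms(22)) measurable
  then show ?thesis by (simp add: W_def[abs_def] r_def \<Lambda>_def)
qed

end
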